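(* Let $p \in [1, \infty) \setminus \{ 2 \}$, let $A = \bigoplus_{j = 1}^M M_{c_j}^p$ and $B = \bigoplus_{k = 1}^N M_{d_k}^p$ (with $M, N, c_j, d_k \in \mathbb{Z}_{>0}$) be spatial semisimple finite dimensional $L^p$ operator algebras, and let $\varphi \colon A \to B$ be a homomorphism. Then $\varphi$ is spatial if and only if $\varphi$ is isometrically similar to a block diagonal homomorphism.
   Context: All algebras are over $\mathbb{C}$; homomorphisms need not be unital. $M_d^p=L(l_d^p)$ is the algebra of $d\times d$ complex matrices with the operator norm on $l_d^p=l^p(\{1,\dots,d\})$; finite direct sums have the norm $\|(a_1,\dots,a_N)\|=\max_k\|a_k\|$. Hermitian idempotent: in a unital Banach algebra with $\|1\|=1$, an idempotent $e$ is hermitian if $\|\exp(i\lambda e)\|=1$ for all $\lambda\in\mathbb{R}$. Spatial: $\varphi\colon\bigoplus_j M_{c_j}^p\to B$ is spatial if for every $j$ the restriction of $\varphi$ to the summand $M_{c_j}^p$ is contractive and sends the identity of $M_{c_j}^p$ to a hermitian idempotent of $B$ (zero allowed). Isometrically similar: homomorphisms $\varphi,\psi\colon A\to B$ are isometrically similar if there is an invertible isometry $s\in B$ (i.e. $s$ invertible with $\|s\|=\|s^{-1}\|=1$) with $\psi(a)=s\varphi(a)s^{-1}$ for all $a\in A$. Block diagonal: a unital homomorphism $\varphi\colon\bigoplus_{j=1}^M M_{c_j}\to M_d$ is block diagonal if there are $n\ge1$ and $r(1),\dots,r(n)\in\{1,\dots,M\}$ with $\sum_{k=1}^n c_{r(k)}=d$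 such that $\varphi(a_1,\dots,a_M)=\mathrm{diag}(a_{r(1)},a_{r(2)},\dots,a_{r(n)})$. A nonunital homomorphism $\varphi\colon\bigoplus_{j=1}^M M_{c_j}\to M_d$ is block diagonal if its unitization $\big(\bigoplus_{j=1}^M M_{c_j}\big)\oplus\mathbb{C}\to M_d$, $(a,\lambda)\mapsto\varphi(a)+\lambda(1-\varphi(1))$, is block diagonal. A homomorphism to $\bigoplus_k M_{d_k}$ is block diagonal if its composition with each projection to $M_{d_k}$ is block diagonal. *)

theory Defs
  imports Complex_Main "Jordan_Normal_Form.Matrix"
begin

text \<open>
  A direct sum of the matrix algebras of sizes \<open>c ! 0, \<dots>, c ! (M - 1)\<close>, where
  \<open>M = length c\<close>, consists of the lists of length \<open>M\<close> whose \<open>j\<close>-th entry is a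
  square matrix of size \<open>c ! j\<close>. The indices of summands start at \<open>0\<close>.
\<close>

definition dsum :: "nat list \<Rightarrow> complex mat list set" where
  "dsum c = {a. length a = length c \<and> (\<forall>j<length c. a ! j \<in> carrier_mat (c ! j) (c ! j))}"

abbreviation dsum_add :: "complex mat list \<Rightarrow> complex mat list \<Rightarrow> complex mat list" where
  "dsum_add \<equiv> map2 (+)"

abbreviation dsum_mult :: "complex mat list \<Rightarrow> complex mat list \<Rightarrow> complex mat list" where
  "dsum_mult \<equiv> map2 (*)"

abbreviation dsum_smult :: "complex \<Rightarrow> complex mat list \<Rightarrow> complex mat list" where
  "dsum_smult z \<equiv> map (\<lambda>x. z \<cdot>\<^sub>m x)"

definition dsum_one :: "nat list \<Rightarrow> complex mat list" where
  "dsum_one c = map 1\<^sub>m c"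

definition dsum_incl :: "nat list \<Rightarrow> nat \<Rightarrow> complex mat \<Rightarrow> complex mat list" where
  "dsum_incl c j x = (map (\<lambda>n. 0\<^sub>m n n) c)[j := x]"

definition lp_norm :: "real \<Rightarrow> complex vec \<Rightarrow> real" where
  "lp_norm p v = (\<Sum>i<dim_vec v. cmod (v $ i) powr p) powr (1 / p)"

definition lp_op_norm :: "real \<Rightarrow> complex mat \<Rightarrow> real" where
  "lp_op_norm p x =
     (SUP v \<in> {v \<in> carrier_vec (dim_col x). lp_norm p v \<le> 1}. lp_norm p (x *\<^sub>v v))"

definition dsum_norm :: "real \<Rightarrow> complex mat list \<Rightarrow> real" where
  "dsum_norm p a = Max (lp_op_norm p ` set a)"

text \<open>
  The exponential series in a direct sum. Since the algebra is finite dimensional, convergence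
  in norm is convergence of all matrix entries, so the series is summed entrywise.
\<close>

definition mat_exp :: "complex mat \<Rightarrow> complex mat" where
  "mat_exp x = mat (dim_row x) (dim_row x) (\<lambda>(i, j). \<Sum>m. (x ^\<^sub>m m) $$ (i, j) / fact m)"

definition dsum_exp :: "complex mat list \<Rightarrow> complex mat list" where
  "dsum_exp = map mat_exp"

definition hermitian_idempotent :: "real \<Rightarrow> nat list \<Rightarrow> complex mat list \<Rightarrow> bool" where
  "hermitian_idempotent p d e \<longleftrightarrow>
     e \<in> dsum d \<and> dsum_mult e e = e \<and>
     (\<forall>t::real. dsum_norm p (dsum_exp (dsum_smult (\<i> * complex_of_real t) e)) = 1)"

text \<open>Homomorphisms need not be unital. Values outside \<open>dsum c\<close> are irrelevant.\<close>

definition dsum_hom :: "nat list \<Rightarrow> nat list \<Rightarrow> (complex mat list \<Rightarrow> complex mat list) \<Rightarrow> bool" where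
  "dsum_hom c d \<phi> \<longleftrightarrow>
     (\<forall>a\<in>dsum c. \<phi> a \<in> dsum d) \<and>
     (\<forall>a\<in>dsum c. \<forall>b\<in>dsum c. \<phi> (dsum_add a b) = dsum_add (\<phi> a) (\<phi> b)) \<and>
     (\<forall>z. \<forall>a\<in>dsum c. \<phi> (dsum_smult z a) = dsum_smult z (\<phi> a)) \<and>
     (\<forall>a\<in>dsum c. \<forall>b\<in>dsum c. \<phi> (dsum_mult a b) = dsum_mult (\<phi> a) (\<phi> b))"

definition spatial ::
    "real \<Rightarrow> nat list \<Rightarrow> nat list \<Rightarrow> (complex mat list \<Rightarrow> complex mat list) \<Rightarrow> bool" where
  "spatial p c d \<phi> \<longleftrightarrow>
     (\<forall>j<length c.
        (\<forall>x\<in>carrier_mat (c ! j) (c ! j). dsum_norm p (\<phi> (dsum_incl c j x)) \<le> lp_op_norm p x) \<and>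
        hermitian_idempotent p d (\<phi> (dsum_incl c j (1\<^sub>m (c ! j)))))"

definition isometrically_similar ::
    "real \<Rightarrow> nat list \<Rightarrow> nat list \<Rightarrow> (complex mat list \<Rightarrow> complex mat list) \<Rightarrow>
     (complex mat list \<Rightarrow> complex mat list) \<Rightarrow> bool" where
  "isometrically_similar p c d \<phi> \<psi> \<longleftrightarrow>
     (\<exists>s\<in>dsum d. \<exists>s'\<in>dsum d.
        dsum_mult s s' = dsum_one d \<and> dsum_mult s' s = dsum_one d \<and>
        dsum_norm p s = 1 \<and> dsum_norm p s' = 1 \<and>
        (\<forall>a\<in>dsum c. \<psi> a = dsum_mult (dsum_mult s (\<phi> a)) s'))"

text \<open>
  The next three definitions concern maps from a direct sum into a single matrix algebra of
  size \<open>n\<close>. The list \<open>r\<close> enumerates the (possibly repeated) summands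
  occurring along the diagonal.
\<close>

definition unital_block_diagonal :: "nat list \<Rightarrow> nat \<Rightarrow> (complex mat list \<Rightarrow> complex mat) \<Rightarrow> bool" where
  "unital_block_diagonal c n \<phi> \<longleftrightarrow>
     (\<exists>r. r \<noteq> [] \<and> set r \<subseteq> {..<length c} \<and> (\<Sum>k\<leftarrow>r. c ! k) = n \<and>
          (\<forall>a\<in>dsum c. \<phi> a = diag_block_mat (map (\<lambda>k. a ! k) r)))"

text \<open>
  The unitization is defined on the direct sum with one more summand of size \<open>1\<close>, placed last,
  whose elements are identified with scalars.
\<close>

definition unitization ::
    "nat list \<Rightarrow> nat \<Rightarrow> (complex mat list \<Rightarrow> complex mat) \<Rightarrow> complex mat list \<Rightarrow> complex mat" where
  "unitization c n \<phi> a = \<phi> (butlast a) + (last a $$ (0, 0)) \<cdot>\<^sub>m (1\<^sub>m n - \<phi> (dsum_one c))"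

definition mat_block_diagonal :: "nat list \<Rightarrow> nat \<Rightarrow> (complex mat list \<Rightarrow> complex mat) \<Rightarrow> bool" where
  "mat_block_diagonal c n \<phi> \<longleftrightarrow>
     (if \<phi> (dsum_one c) = 1\<^sub>m n then unital_block_diagonal c n \<phi>
      else unital_block_diagonal (c @ [1]) n (unitization c n \<phi>))"

definition block_diagonal ::
    "nat list \<Rightarrow> nat list \<Rightarrow> (complex mat list \<Rightarrow> complex mat list) \<Rightarrow> bool" where
  "block_diagonal c d \<phi> \<longleftrightarrow> (\<forall>k<length d. mat_block_diagonal c (d ! k) (\<lambda>a. \<phi> a ! k))"

end

theory Submission
  imports Defs
begin

text \<open>
  Everything rests on one rigidity fact: for \<open>p \<noteq> 2\<close> a hermitian idempotent of \<open>L(\<ell>\<^sup>p)\<close> on a finite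
  set is the projection onto the span of some of the coordinate vectors
  (\<open>hermitian_idempotent_coord_proj\<close>). For \<open>p = 2\<close> every orthogonal projection is hermitian and the
  argument collapses. To see the fact, note that for idempotent \<open>E\<close> the exponential \<open>exp(i t E)\<close> is
  \<open>1 + (z - 1) E\<close> with \<open>z = exp(i t)\<close>, so \<open>E\<close> is hermitian iff all these matrices are contractions, and
  then they are isometries because \<open>1 + (1/z - 1) E\<close> is inverse. Applied to the \<open>i\<close>-th coordinate
  vector this says \<open>|1 + (z - 1) \<alpha>|\<^sup>p + |z - 1|\<^sup>p C = 1\<close> for all \<open>z\<close> on the unit circle, where \<open>\<alpha>\<close> is
  the \<open>i\<close>-th diagonal entry and \<open>C\<close> the sum of the \<open>p\<close>-th powers of the moduli of the remaining entries
  of that column. Comparing orders of vanishing at \<open>z = 1\<close> forces \<open>C = 0\<close>, and then \<open>\<alpha>\<close> is \<open>0\<close> or \<open>1\<close>.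

  Let \<open>\<phi>\<close> be spatial. Fix one summand of the target, of size \<open>n\<close>, and let \<open>F j k i\<close> be the component
  there of the image of the matrix unit \<open>e\<^sub>k\<^sub>i\<close> of the \<open>j\<close>-th summand. Each \<open>F j i i\<close> is a hermitian
  idempotent: it is one inside the corner cut out by the image of the identity of the summand, which
  is itself a coordinate projection (\<open>lp_hermitian_corner\<close>). So the \<open>F j i i\<close> are projections onto
  disjoint sets \<open>S j i\<close> of coordinates. Suppose first that the component is unital, so that these sets
  cover all the coordinates. The contractions \<open>F j 0 i\<close> and \<open>F j i 0\<close> restrict to mutually inverse maps
  between \<open>\<ell>\<^sup>p(S j i)\<close> and \<open>\<ell>\<^sup>p(S j 0)\<close>, hence to isometries. The matrix \<open>s\<close> with rows indexed by the
  triples \<open>(j, x, i)\<close> with \<open>x \<in> S j 0\<close>, whose row at \<open>(j, x, i)\<close> is row \<open>x\<close> of \<open>F j 0 i\<close>, moves each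
  \<open>\<ell>\<^sup>p(S j i)\<close> isometrically onto a set of coordinates, with disjoint sets for different \<open>(j, i)\<close>; so \<open>s\<close>
  is an isometry. Conjugation by \<open>s\<close> turns the component of \<open>\<phi>(a)\<close> into the block diagonal matrix with one
  block \<open>a\<^sub>j\<close> for each pair \<open>(j, x)\<close>, by the multiplication rules for matrix units
  (\<open>isometry_to_block_diagonal\<close>). If the component is not unital, the same argument applies to its
  unitization, where \<open>1 - \<phi>(1)\<close> is one more coordinate projection
  (\<open>mat_hom_block_diagonalization\<close>).

  Conversely, the norm of a block diagonal matrix is at most the largest norm of a block, and a block
  diagonal matrix with blocks \<open>1\<close> and \<open>0\<close> is hermitian. Both the norm bound and hermitianness survive
  conjugation by an invertible isometry (\<open>similar_block_diagonal_imp_spatial\<close>).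
\<close>

section \<open>The \<open>\<ell>\<^sup>p\<close> operator norm of a matrix\<close>

text \<open>
  The \<open>p\<close>-th power of the \<open>\<ell>\<^sup>p\<close> norm is additive over disjoint sets of coordinates, so most estimates
  below are carried out with it.
\<close>

definition lp_sum :: "real \<Rightarrow> complex vec \<Rightarrow> real" where
  "lp_sum p v = (\<Sum>i<dim_vec v. cmod (v $ i) powr p)"

text \<open>
  Operator norm bounds are used in this pointwise form, which avoids suprema; the two agree by
  \<open>lp_op_norm_le_iff\<close>.
\<close>

definition lp_bounded :: "real \<Rightarrow> real \<Rightarrow> complex mat \<Rightarrow> bool" where
  "lp_bounded p K A \<longleftrightarrow>
     (\<forall>v\<in>carrier_vec (dim_col A). lp_norm p (A *\<^sub>v v) \<le> K * lp_norm p v)"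

abbreviation lp_contraction :: "real \<Rightarrow> complex mat \<Rightarrow> bool" where
  "lp_contraction p \<equiv> lp_bounded p 1"

lemma lp_sum_nonneg: "0 \<le> lp_sum p v"
  by (simp add: lp_sum_def sum_nonneg)

lemma lp_norm_nonneg: "0 \<le> lp_norm p v"
  by (simp add: lp_norm_def)

lemma lp_norm_powr: "0 < p \<Longrightarrow> lp_norm p v powr p = lp_sum p v"
  using lp_sum_nonneg[of p v] by (simp add: lp_norm_def lp_sum_def powr_powr)

lemma lp_norm_le_iff:
  assumes "0 < p" "0 \<le> K"
  shows "lp_norm p u \<le> K * lp_norm p v \<longleftrightarrow> lp_sum p u \<le> K powr p * lp_sum p v"
proof -
  have "lp_norm p u \<le> K * lp_norm p v \<longleftrightarrow> lp_norm p u powr p \<le> (K * lp_norm p v) powr p"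
    using assms lp_norm_nonneg[of p u] lp_norm_nonneg[of p v] powr_mono2
    by (smt (verit) mult_nonneg_nonneg powr_less_mono2)
  thus ?thesis using assms lp_norm_nonneg by (simp add: powr_mult lp_norm_powr)
qed

lemma lp_contraction_iff:
  assumes "0 < p"
  shows "lp_contraction p A \<longleftrightarrow>
    (\<forall>v\<in>carrier_vec (dim_col A). lp_sum p (A *\<^sub>v v) \<le> lp_sum p v)"
  using lp_norm_le_iff[OF assms, of 1] by (simp add: lp_bounded_def)

lemma lp_sum_smult: "lp_sum p (z \<cdot>\<^sub>v v) = cmod z powr p * lp_sum p v"
  by (simp add: lp_sum_def norm_mult powr_mult sum_distrib_left)

lemma lp_norm_smult: "0 < p \<Longrightarrow> lp_norm p (z \<cdot>\<^sub>v v) = cmod z * lp_norm p v"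
proof -
  assume p: "0 < p"
  have "lp_norm p (z \<cdot>\<^sub>v v) = (lp_sum p (z \<cdot>\<^sub>v v)) powr (1 / p)"
    by (simp add: lp_norm_def lp_sum_def)
  also have "\<dots> = cmod z * lp_norm p v" using p
    by (simp add: lp_sum_smult powr_mult lp_sum_nonneg powr_powr)
       (simp add: lp_norm_def lp_sum_def)
  finally show ?thesis .
qed

lemma lp_sum_eq_0: "lp_sum p v = 0 \<Longrightarrow> v = 0\<^sub>v (dim_vec v)"
  by (intro eq_vecI) (auto simp: lp_sum_def sum_nonneg_eq_0_iff)

lemma lp_sum_zero [simp]: "lp_sum p (0\<^sub>v n) = 0"
  by (simp add: lp_sum_def)

lemma lp_norm_zero [simp]: "lp_norm p (0\<^sub>v n) = 0"
  by (simp add: lp_norm_def)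

lemma lp_norm_eq_0: "0 < p \<Longrightarrow> lp_norm p v = 0 \<Longrightarrow> v = 0\<^sub>v (dim_vec v)"
  using lp_norm_powr[of p v] lp_sum_eq_0[of p v] by simp

lemma lp_sum_append: "lp_sum p (u @\<^sub>v v) = lp_sum p u + lp_sum p v"
proof -
  let ?f = "\<lambda>i. cmod ((u @\<^sub>v v) $ i) powr p"
  have "lp_sum p (u @\<^sub>v v) = sum ?f {..<dim_vec u + dim_vec v}"
    by (simp add: lp_sum_def)
  also have "\<dots> = sum ?f {..<dim_vec u} + sum ?f {dim_vec u..<dim_vec u + dim_vec v}"
  proof -
    have "{..<dim_vec u + dim_vec v} = {..<dim_vec u} \<union> {dim_vec u..<dim_vec u + dim_vec v}"
      by auto
    thus ?thesis using sum.union_disjoint[of "{..<dim_vec u}" "{dim_vec u..<dim_vec u + dim_vec v}" ?f]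
      by force
  qed
  also have "sum ?f {dim_vec u..<dim_vec u + dim_vec v} = (\<Sum>i<dim_vec v. ?f (dim_vec u + i))"
    by (rule sum.reindex_bij_witness[of _ "\<lambda>i. dim_vec u + i" "\<lambda>i. i - dim_vec u"]) auto
  also have "sum ?f {..<dim_vec u} + (\<Sum>i<dim_vec v. ?f (dim_vec u + i)) = lp_sum p u + lp_sum p v"
    unfolding lp_sum_def by (intro arg_cong2[of _ _ _ _ "(+)"] sum.cong) auto
  finally show ?thesis .
qed

lemma lp_sum_unit_vec: "i < n \<Longrightarrow> lp_sum p (unit_vec n i) = 1"
  by (simp add: lp_sum_def if_distrib[of cmod] if_distrib[of "\<lambda>x. x powr p"] cong: if_cong)

text \<open>
  The supremum that defines the operator norm is only meaningful once its set is bounded above. A crude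
  bound suffices: every coordinate of \<open>v\<close> is at most the norm of \<open>v\<close>.
\<close>

lemma lp_bounded_exists:
  assumes "0 < p"
  shows "\<exists>K\<ge>0. lp_bounded p K A"
proof -
  define M where "M = (\<Sum>i<dim_row A. (\<Sum>l<dim_col A. cmod (A $$ (i, l))) powr p)"
  have M: "0 \<le> M" by (simp add: M_def sum_nonneg)
  have "lp_sum p (A *\<^sub>v v) \<le> (M powr (1 / p)) powr p * lp_sum p v"
    if v: "v \<in> carrier_vec (dim_col A)" for v
  proof -
    have coord: "cmod (v $ l) \<le> lp_norm p v" if "l < dim_vec v" for l
    proof -
      have "cmod (v $ l) powr p \<le> lp_norm p v powr p"
        unfolding lp_norm_powr[OF assms] lp_sum_def
        by (rule member_le_sum) (use that in auto)
      thus ?thesis using assms powr_less_mono2[of p "lp_norm p v" "cmod (v $ l)"] lp_norm_nonneg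
        by force
    qed
    have "cmod ((A *\<^sub>v v) $ i) powr p
        \<le> (\<Sum>l<dim_col A. cmod (A $$ (i, l))) powr p * lp_sum p v" if i: "i < dim_row A" for i
    proof -
      have "cmod ((A *\<^sub>v v) $ i) \<le> (\<Sum>l<dim_col A. cmod (A $$ (i, l)) * lp_norm p v)"
        using i v coord unfolding index_mult_mat_vec[OF i] scalar_prod_def
        by (auto intro!: sum_norm_le mult_left_mono simp: norm_mult atLeast0LessThan)
      hence "cmod ((A *\<^sub>v v) $ i) powr p
          \<le> ((\<Sum>l<dim_col A. cmod (A $$ (i, l))) * lp_norm p v) powr p"
        using assms by (intro powr_mono2) (auto simp: sum_distrib_right)
      thus ?thesis
        using assms lp_norm_nonneg[of p v] by (simp add: powr_mult sum_nonneg lp_norm_powr)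
    qed
    hence "lp_sum p (A *\<^sub>v v) \<le> M * lp_sum p v"
      unfolding M_def sum_distrib_right lp_sum_def[of p "A *\<^sub>v v"] dim_mult_mat_vec
      by (intro sum_mono) auto
    thus ?thesis using M assms by (simp add: powr_powr)
  qed
  hence "lp_bounded p (M powr (1 / p)) A"
    using lp_norm_le_iff[OF assms] by (simp add: lp_bounded_def)
  thus ?thesis by (intro exI[of _ "M powr (1 / p)"]) simp
qed

lemma lp_op_norm_le_iff:
  assumes p: "0 < p" and K: "0 \<le> K"
  shows "lp_op_norm p A \<le> K \<longleftrightarrow> lp_bounded p K A"
proof -
  define B where "B = {v \<in> carrier_vec (dim_col A). lp_norm p v \<le> 1}"
  obtain M where M: "0 \<le> M" "lp_bounded p M A" using lp_bounded_exists[OF p] by blast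
  have "lp_norm p (A *\<^sub>v v) \<le> M" if "v \<in> B" for v
  proof -
    have "lp_norm p (A *\<^sub>v v) \<le> M * lp_norm p v" using M that by (auto simp: lp_bounded_def B_def)
    also have "\<dots> \<le> M * 1" using M that by (intro mult_left_mono) (auto simp: B_def)
    finally show ?thesis by simp
  qed
  hence bdd: "bdd_above ((\<lambda>v. lp_norm p (A *\<^sub>v v)) ` B)" by (auto simp: bdd_above_def)
  have ne: "B \<noteq> {}"
  proof -
    have "0\<^sub>v (dim_col A) \<in> B" by (simp add: B_def)
    thus ?thesis by auto
  qed
  have "lp_op_norm p A \<le> K \<longleftrightarrow> (\<forall>v\<in>B. lp_norm p (A *\<^sub>v v) \<le> K)"
    unfolding lp_op_norm_def B_def[symmetric] using cSUP_le_iff[OF ne bdd] by simp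
  also have "\<dots> \<longleftrightarrow> lp_bounded p K A"
  proof
    assume *: "\<forall>v\<in>B. lp_norm p (A *\<^sub>v v) \<le> K"
    show "lp_bounded p K A"
      unfolding lp_bounded_def
    proof
      fix v :: "complex vec" assume v: "v \<in> carrier_vec (dim_col A)"
      show "lp_norm p (A *\<^sub>v v) \<le> K * lp_norm p v"
      proof (cases "lp_norm p v = 0")
        case True
        hence "v = 0\<^sub>v (dim_col A)" using lp_norm_eq_0[OF p True] v by simp
        hence "A *\<^sub>v v = 0\<^sub>v (dim_row A)" by auto
        thus ?thesis using True by simp
      next
        case False
        hence pos: "0 < lp_norm p v" using lp_norm_nonneg[of p v] by simp
        define z where "z = complex_of_real (1 / lp_norm p v)"
        have z: "cmod z = 1 / lp_norm p v"
          unfolding z_def norm_of_real using pos by simp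
        have "z \<cdot>\<^sub>v v \<in> B" using v pos by (simp add: B_def lp_norm_smult[OF p] z)
        hence "lp_norm p (A *\<^sub>v (z \<cdot>\<^sub>v v)) \<le> K" using * by blast
        also have "A *\<^sub>v (z \<cdot>\<^sub>v v) = z \<cdot>\<^sub>v (A *\<^sub>v v)" by (rule mult_mat_vec[OF carrier_mat_triv v])
        finally show ?thesis using pos by (simp add: lp_norm_smult[OF p] z field_simps)
      qed
    qed
  next
    assume *: "lp_bounded p K A"
    show "\<forall>v\<in>B. lp_norm p (A *\<^sub>v v) \<le> K"
    proof
      fix v assume v: "v \<in> B"
      hence "lp_norm p (A *\<^sub>v v) \<le> K * lp_norm p v" using * by (auto simp: lp_bounded_def B_def)
      also have "\<dots> \<le> K * 1" using K v by (intro mult_left_mono) (auto simp: B_def)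
      finally show "lp_norm p (A *\<^sub>v v) \<le> K" by simp
    qed
  qed
  finally show ?thesis .
qed

lemma lp_op_norm_nonneg:
  assumes "0 < p"
  shows "0 \<le> lp_op_norm p A"
proof (rule ccontr)
  assume neg: "\<not> 0 \<le> lp_op_norm p A"
  obtain M where "0 \<le> M" "lp_bounded p M A" using lp_bounded_exists[OF assms] by blast
  let ?B = "{v \<in> carrier_vec (dim_col A). lp_norm p v \<le> 1}"
  have "lp_bounded p 0 A" using neg lp_op_norm_le_iff[OF assms, of 0 A] by linarith
  hence "lp_norm p (A *\<^sub>v v) = 0" if "v \<in> ?B" for v
    using that lp_norm_nonneg[of p "A *\<^sub>v v"] by (auto simp: lp_bounded_def intro: antisym)
  hence "lp_op_norm p A = (SUP v\<in>?B. 0)"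
    unfolding lp_op_norm_def by (intro SUP_cong) auto
  moreover have "0\<^sub>v (dim_col A) \<in> ?B" by simp
  hence "?B \<noteq> {}" by blast
  ultimately show False using neg by simp
qed

lemma lp_bounded_op_norm: "0 < p \<Longrightarrow> lp_bounded p (lp_op_norm p A) A"
  using lp_op_norm_le_iff lp_op_norm_nonneg by blast

lemma lp_bounded_mult:
  assumes "A \<in> carrier_mat n m" "B \<in> carrier_mat m l" "lp_bounded p K A" "lp_bounded p L B" "0 \<le> K"
  shows "lp_bounded p (K * L) (A * B)"
  unfolding lp_bounded_def
proof
  fix v :: "complex vec" assume "v \<in> carrier_vec (dim_col (A * B))"
  hence v: "v \<in> carrier_vec l" using assms by simp
  have "lp_norm p ((A * B) *\<^sub>v v) = lp_norm p (A *\<^sub>v (B *\<^sub>v v))"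
    using assms v by simp
  also have "\<dots> \<le> K * lp_norm p (B *\<^sub>v v)"
    using assms v by (simp add: lp_bounded_def)
  also have "\<dots> \<le> K * (L * lp_norm p v)"
    using assms v by (intro mult_left_mono) (simp_all add: lp_bounded_def)
  finally show "lp_norm p ((A * B) *\<^sub>v v) \<le> K * L * lp_norm p v" by simp
qed

lemma lp_contraction_mult:
  assumes "A \<in> carrier_mat n m" "B \<in> carrier_mat m l" "lp_contraction p A" "lp_contraction p B"
  shows "lp_contraction p (A * B)"
  using lp_bounded_mult[OF assms] by simp

text \<open>
  A contraction with contractive inverse is an isometry. Invertible isometries enter and leave the
  argument in this form.
\<close>

lemma lp_norm_invertible_contraction:
  assumes "V \<in> carrier_mat n n" "W \<in> carrier_mat n n" "W * V = 1\<^sub>m n"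
    and "lp_contraction p V" "lp_contraction p W" and v: "v \<in> carrier_vec n"
  shows "lp_norm p (V *\<^sub>v v) = lp_norm p v"
proof (rule antisym)
  show "lp_norm p (V *\<^sub>v v) \<le> lp_norm p v" using assms by (auto simp: lp_bounded_def)
  have "lp_norm p v = lp_norm p (W *\<^sub>v (V *\<^sub>v v))"
    using assms by (simp flip: assoc_mult_mat_vec)
  also have "\<dots> \<le> lp_norm p (V *\<^sub>v v)" using assms by (auto simp: lp_bounded_def)
  finally show "lp_norm p v \<le> lp_norm p (V *\<^sub>v v)" .
qed

lemma lp_op_norm_invertible_contraction:
  assumes "0 < p" "0 < n" "V \<in> carrier_mat n n" "W \<in> carrier_mat n n" "W * V = 1\<^sub>m n"
    and "lp_contraction p V" "lp_contraction p W"
  shows "lp_op_norm p V = 1"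
proof (rule antisym)
  show "lp_op_norm p V \<le> 1" using assms by (simp add: lp_op_norm_le_iff)
  define e :: "complex vec" where "e = unit_vec n 0"
  have e: "e \<in> carrier_vec n" by (simp add: e_def)
  have "lp_norm p e = (lp_sum p e) powr (1 / p)" by (simp add: lp_norm_def lp_sum_def)
  hence e1: "lp_norm p e = 1" using assms(2) by (simp add: e_def lp_sum_unit_vec)
  have "lp_norm p (V *\<^sub>v e) \<le> lp_op_norm p V * lp_norm p e"
    using lp_bounded_op_norm[OF assms(1), of V] e assms(3) by (auto simp: lp_bounded_def)
  thus "1 \<le> lp_op_norm p V"
    using lp_norm_invertible_contraction[OF assms(3-7) e] e1 by simp
qed

section \<open>Hermitian idempotents for \<open>p \<noteq> 2\<close>\<close>

definition coord_proj :: "nat \<Rightarrow> nat set \<Rightarrow> complex mat" where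
  "coord_proj n S = mat n n (\<lambda>(x, y). if x = y \<and> x \<in> S then 1 else 0)"

text \<open>
  For idempotent \<open>E\<close> the matrix \<open>1 + (z - 1) E\<close> with \<open>z = exp(i t)\<close> is \<open>exp(i t E)\<close>, see
  \<open>mat_exp_smult_idempotent\<close>. Contractivity for all \<open>z\<close> already makes these matrices isometries.
\<close>

definition lp_hermitian :: "real \<Rightarrow> nat \<Rightarrow> complex mat \<Rightarrow> bool" where
  "lp_hermitian p n E \<longleftrightarrow>
     (\<forall>z. cmod z = 1 \<longrightarrow> lp_contraction p (1\<^sub>m n + (z - 1) \<cdot>\<^sub>m E))"

lemma ex_powr_small:
  fixes b e r :: real
  assumes "0 < b" "0 < e" "0 < r"
  shows "\<exists>t>0. t \<le> b \<and> t powr r \<le> e"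
proof (intro exI conjI)
  define t where "t = min b (e powr (1 / r))"
  show "0 < t" "t \<le> b" using assms by (auto simp: t_def)
  have "t powr r \<le> (e powr (1 / r)) powr r"
    using assms by (intro powr_mono2) (auto simp: t_def)
  thus "t powr r \<le> e" using assms by (simp add: powr_powr)
qed

text \<open>
  As \<open>t\<close> tends to \<open>0\<close>, the deficit \<open>1 - (1 - t)\<^sup>q\<close> has order \<open>t\<close> while \<open>C t\<^sup>q\<close> has order \<open>t\<^sup>q\<close>, so they
  cannot agree near \<open>0\<close> unless \<open>q = 1\<close>. Comparing \<open>(1 - t)\<^sup>q\<close> with \<open>1 - t\<close> gives a bound in the direction
  needed in each of the cases \<open>q < 1\<close> and \<open>q > 1\<close>.
\<close>

lemma powr_sum_not_constant:
  fixes q b C :: real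
  assumes q: "0 < q" "q \<noteq> 1" and b: "0 < b" and C: "0 < C"
    and eq: "\<And>t. 0 < t \<Longrightarrow> t \<le> b \<Longrightarrow> t \<le> 1 \<and> (1 - t) powr q + C * t powr q = 1"
  shows False
proof (cases "q < 1")
  case True
  obtain t where t: "0 < t" "t \<le> b" "t powr (1 - q) \<le> C / 2"
    using ex_powr_small[of b "C / 2" "1 - q"] b C True by auto
  have t1: "t \<le> 1" and e: "(1 - t) powr q + C * t powr q = 1" using eq t by auto
  have "1 - t \<le> (1 - t) powr q"
    using powr_mono'[of q 1 "1 - t"] True t t1 by simp
  hence "C * t powr q \<le> t powr (1 - q) * t powr q"
    using e t by (simp flip: powr_add)
  hence "C \<le> t powr (1 - q)" using t by simp
  thus False using t C by simp
next
  case False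
  hence q1: "1 < q" using q by simp
  obtain t where t: "0 < t" "t \<le> b" "t powr (q - 1) \<le> 1 / (2 * C)"
    using ex_powr_small[of b "1 / (2 * C)" "q - 1"] b C q1 by auto
  have t1: "t \<le> 1" and e: "(1 - t) powr q + C * t powr q = 1" using eq t by auto
  have "(1 - t) powr q \<le> 1 - t"
    using powr_mono'[of 1 q "1 - t"] q1 t t1 by simp
  hence "t * 1 \<le> C * t powr (1 + (q - 1))" using e by simp
  also have "\<dots> = t * (C * t powr (q - 1))" using t by (subst powr_add) simp
  finally have "1 \<le> C * t powr (q - 1)" using t by (simp only: mult_le_cancel_left_pos)
  also have "\<dots> \<le> C * (1 / (2 * C))" using t C by (intro mult_left_mono) auto
  finally show False using C by simp
qed

text \<open>
  Comparing \<open>z = i\<close> with \<open>z = -i\<close>, which are equally far from \<open>1\<close>, shows that \<open>\<alpha>\<close> is real. With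
  \<open>u = |z - 1|\<^sup>2\<close>, which ranges over the interval from \<open>0\<close> to \<open>4\<close>, one then has
  \<open>|1 + (z - 1) \<alpha>|\<^sup>2 = 1 - u \<alpha> (1 - \<alpha>)\<close>, so that the hypothesis is an identity between real powers of
  exponent \<open>p / 2\<close>, to which \<open>powr_sum_not_constant\<close> applies.
\<close>

lemma circle_identity_imp_0_or_1:
  fixes \<alpha> :: complex
  assumes p: "0 < p" "p \<noteq> 2" and C: "0 \<le> C"
    and eq: "\<And>z. cmod z = 1 \<Longrightarrow> cmod (1 + (z - 1) * \<alpha>) powr p + cmod (z - 1) powr p * C = 1"
  shows "C = 0 \<and> (\<alpha> = 0 \<or> \<alpha> = 1)"
proof -
  define x where "x = Re \<alpha>"
  have "cmod (\<i> - 1) = cmod (- \<i> - 1)" by (simp add: cmod_def)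
  hence "cmod (1 + (\<i> - 1) * \<alpha>) powr p = cmod (1 + (- \<i> - 1) * \<alpha>) powr p"
    using eq[of \<i>] eq[of "- \<i>"] by simp
  hence "cmod (1 + (\<i> - 1) * \<alpha>) = cmod (1 + (- \<i> - 1) * \<alpha>)"
    using p powr_less_mono2[of p "cmod (1 + (\<i> - 1) * \<alpha>)" "cmod (1 + (- \<i> - 1) * \<alpha>)"]
      powr_less_mono2[of p "cmod (1 + (- \<i> - 1) * \<alpha>)" "cmod (1 + (\<i> - 1) * \<alpha>)"]
    by (cases rule: linorder_cases) auto
  hence "(cmod (1 + (\<i> - 1) * \<alpha>))\<^sup>2 = (cmod (1 + (- \<i> - 1) * \<alpha>))\<^sup>2" by simp
  hence "Im \<alpha> = 0" unfolding cmod_power2 by (simp add: power2_eq_square algebra_simps)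
  hence \<alpha>: "\<alpha> = complex_of_real x" by (simp add: x_def complex_eq_iff)
  define \<beta> q where "\<beta> = x - x\<^sup>2" and "q = p / 2"
  have sq: "cmod w powr p = (cmod w)\<^sup>2 powr q" for w
  proof -
    have "(cmod w)\<^sup>2 powr q = (cmod w powr 2) powr q" by simp
    thus ?thesis unfolding powr_powr by (simp add: q_def)
  qed
  have uc: "u * \<beta> \<le> 1 \<and> (1 - u * \<beta>) powr q + C * u powr q = 1" if u: "0 < u" "u \<le> 4" for u
  proof -
    \<comment> \<open>A point of the unit circle at squared distance \<open>u\<close> from \<open>1\<close>.\<close>
    define z where "z = Complex (1 - u / 2) (sqrt (u - u\<^sup>2 / 4))"
    have nn: "0 \<le> u - u\<^sup>2 / 4" using u by (simp add: power2_eq_square field_simps)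
    have "(cmod z)\<^sup>2 = 1" unfolding cmod_power2 using nn
      by (simp add: z_def power2_eq_square field_simps)
    hence z: "cmod z = 1" by (simp add: power2_eq_1_iff) (smt (verit) norm_ge_zero)
    have z1: "(cmod (z - 1))\<^sup>2 = u" unfolding cmod_power2 using nn
      by (simp add: z_def power2_eq_square field_simps)
    have "(cmod (1 + (z - 1) * \<alpha>))\<^sup>2 = (1 - u * x / 2)\<^sup>2 + (u - u\<^sup>2 / 4) * x\<^sup>2"
      unfolding cmod_power2 using nn
      by (simp add: \<alpha> z_def power_mult_distrib)
    also have "\<dots> = 1 - u * \<beta>" by (simp add: \<beta>_def power2_eq_square field_simps)
    finally have z2: "(cmod (1 + (z - 1) * \<alpha>))\<^sup>2 = 1 - u * \<beta>" .
    have "0 \<le> 1 - u * \<beta>" unfolding z2[symmetric] by simp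
    thus ?thesis using eq[OF z] unfolding sq z1 z2 by (simp add: mult.commute)
  qed
  have q: "0 < q" "q \<noteq> 1" using p by (auto simp: q_def)
  have C0: "C = 0"
  proof (rule ccontr)
    assume "C \<noteq> 0"
    hence C: "0 < C" using C by simp
    have "(1 - 4 * \<beta>) powr q < 1" using uc[of 4] C by (simp add: algebra_simps) (smt (verit) mult_pos_pos powr_gt_zero)
    hence \<beta>: "0 < \<beta>" using q ge_one_powr_ge_zero[of "1 - 4 * \<beta>" q] by force
    \<comment> \<open>Substitute \<open>t = u \<beta>\<close>.\<close>
    show False
    proof (rule powr_sum_not_constant[OF q, of "4 * \<beta>" "C / \<beta> powr q"])
      fix t assume t: "0 < t" "t \<le> 4 * \<beta>"
      have "t / \<beta> * \<beta> \<le> 1 \<and> (1 - t / \<beta> * \<beta>) powr q + C * (t / \<beta>) powr q = 1"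
        using t \<beta> by (intro uc) (auto simp: field_simps)
      thus "t \<le> 1 \<and> (1 - t) powr q + C / \<beta> powr q * t powr q = 1"
        using t \<beta> by (simp add: powr_divide)
    qed (use \<beta> C in auto)
  qed
  have "(1 - 4 * \<beta>) powr q = 1" "0 \<le> 1 - 4 * \<beta>" using uc[of 4] C0 by auto
  hence "1 - 4 * \<beta> = 1"
    using q powr_less_mono2[of q "1 - 4 * \<beta>" 1] powr_less_mono2[of q 1 "1 - 4 * \<beta>"] by force
  hence "x * (1 - x) = 0" by (simp add: \<beta>_def power2_eq_square algebra_simps)
  thus ?thesis using C0 \<alpha> by auto
qed

lemma smult_smult_mat: "a \<cdot>\<^sub>m (b \<cdot>\<^sub>m A) = (a * b) \<cdot>\<^sub>m A" for A :: "complex mat"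
  by (intro eq_matI) (auto simp: mult.assoc)

lemma one_plus_idempotent_mult:
  fixes E :: "complex mat"
  assumes E: "E \<in> carrier_mat n n" "E * E = E"
  shows "(1\<^sub>m n + (z - 1) \<cdot>\<^sub>m E) * (1\<^sub>m n + (w - 1) \<cdot>\<^sub>m E) = 1\<^sub>m n + (z * w - 1) \<cdot>\<^sub>m E"
proof -
  have [simp]: "row E i \<bullet> col E j = E $$ (i, j)" if "i < n" "j < n" for i j
    using that E by (metis carrier_matD index_mult_mat(1))
  show ?thesis
    using E(1)
    by (simp add: add_mult_distrib_mat[of _ n n _ _ n] mult_add_distrib_mat[of _ n n _ n]
        mult_smult_distrib[of _ n n _ n])
       (intro eq_matI, auto simp: algebra_simps)
qed

text \<open>
  The image of the \<open>i\<close>-th coordinate vector under the isometry \<open>1 + (z - 1) E\<close> has norm \<open>1\<close> for every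
  \<open>z\<close> on the unit circle. Its \<open>i\<close>-th coordinate is \<open>1 + (z - 1) E\<^sub>i\<^sub>i\<close> and the others are
  \<open>(z - 1) E\<^sub>l\<^sub>i\<close>, which is the situation of \<open>circle_identity_imp_0_or_1\<close>.
\<close>

lemma hermitian_idempotent_coord_proj:
  assumes p: "0 < p" "p \<noteq> 2" and E: "E \<in> carrier_mat n n" "E * E = E"
    and herm: "lp_hermitian p n E"
  shows "E = coord_proj n {i. i < n \<and> E $$ (i, i) = 1}"
proof -
  have col: "(\<forall>l<n. l \<noteq> i \<longrightarrow> E $$ (l, i) = 0) \<and> (E $$ (i, i) = 0 \<or> E $$ (i, i) = 1)"
    if i: "i < n" for i
  proof -
    define C where "C = (\<Sum>l\<in>{..<n} - {i}. cmod (E $$ (l, i)) powr p)"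
    have "C = 0 \<and> (E $$ (i, i) = 0 \<or> E $$ (i, i) = 1)"
    proof (rule circle_identity_imp_0_or_1[OF p])
      show "0 \<le> C" by (simp add: C_def sum_nonneg)
      fix z assume z: "cmod z = 1"
      define V W where "V = 1\<^sub>m n + (z - 1) \<cdot>\<^sub>m E" and "W = 1\<^sub>m n + (cnj z - 1) \<cdot>\<^sub>m E"
      have "cnj z * z = 1" using z by (metis complex_norm_square mult.commute of_real_1 one_power2)
      hence WV: "W * V = 1\<^sub>m n"
        using E by (simp add: V_def W_def one_plus_idempotent_mult) (intro eq_matI, auto)
      have V: "V \<in> carrier_mat n n" "W \<in> carrier_mat n n" using E by (auto simp: V_def W_def)
      have "lp_norm p (V *\<^sub>v unit_vec n i) = lp_norm p (unit_vec n i)"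
        using herm z by (intro lp_norm_invertible_contraction[OF V WV])
          (auto simp: lp_hermitian_def V_def W_def)
      hence "lp_sum p (V *\<^sub>v unit_vec n i) = 1"
        using p i lp_norm_powr[of p "V *\<^sub>v unit_vec n i"] lp_norm_powr[of p "unit_vec n i"]
          lp_sum_unit_vec[of i n p] by metis
      moreover have "(V *\<^sub>v unit_vec n i) $ l = (if l = i then 1 else 0) + (z - 1) * E $$ (l, i)"
        if "l < n" for l
        using that i E V by (simp add: V_def)
      ultimately have "(\<Sum>l<n. cmod ((if l = i then 1 else 0) + (z - 1) * E $$ (l, i)) powr p) = 1"
        using V by (simp add: lp_sum_def)
      hence "cmod (1 + (z - 1) * E $$ (i, i)) powr p +
          (\<Sum>l\<in>{..<n} - {i}. cmod ((z - 1) * E $$ (l, i)) powr p) = 1"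
        using i by (subst (asm) sum.remove[of _ i]) auto
      thus "cmod (1 + (z - 1) * E $$ (i, i)) powr p + cmod (z - 1) powr p * C = 1"
        by (simp add: C_def sum_distrib_left norm_mult powr_mult)
    qed
    thus ?thesis by (auto simp: C_def sum_nonneg_eq_0_iff)
  qed
  show ?thesis
  proof (rule eq_matI)
    fix l i assume "l < dim_row (coord_proj n {i. i < n \<and> E $$ (i, i) = 1})"
      "i < dim_col (coord_proj n {i. i < n \<and> E $$ (i, i) = 1})"
    thus "E $$ (l, i) = coord_proj n {i. i < n \<and> E $$ (i, i) = 1} $$ (l, i)"
      using col[of i] by (cases "l = i") (auto simp: coord_proj_def)
  qed (use E in \<open>auto simp: coord_proj_def\<close>)
qed

lemma mat_exp_smult_idempotent:
  assumes E: "E \<in> carrier_mat n n" "E * E = E"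
  shows "mat_exp (w \<cdot>\<^sub>m E) = 1\<^sub>m n + (exp w - 1) \<cdot>\<^sub>m E"
proof -
  have pow: "(w \<cdot>\<^sub>m E) ^\<^sub>m Suc m = w ^ Suc m \<cdot>\<^sub>m E" for m
  proof (induction m)
    case 0
    show ?case using E by simp
  next
    case (Suc m)
    have "(w \<cdot>\<^sub>m E) ^\<^sub>m Suc (Suc m) = (w ^ Suc m \<cdot>\<^sub>m E) * (w \<cdot>\<^sub>m E)"
      by (simp only: pow_mat.simps(2)[of _ "Suc m"] Suc)
    also have "\<dots> = w ^ Suc (Suc m) \<cdot>\<^sub>m E"
      using E by (simp add: mult_smult_distrib[of _ n n _ n] mult_smult_assoc_mat[of _ n n _ n]
        smult_smult_mat mult_ac)
    finally show ?case .
  qed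
  show ?thesis
  proof (rule eq_matI)
    fix i j assume ij: "i < dim_row (1\<^sub>m n + (exp w - 1) \<cdot>\<^sub>m E)" "j < dim_col (1\<^sub>m n + (exp w - 1) \<cdot>\<^sub>m E)"
    hence ij: "i < n" "j < n" using E by auto
    let ?d = "if i = j then 1 else 0 :: complex"
    have "((w \<cdot>\<^sub>m E) ^\<^sub>m m) $$ (i, j) / fact m
        = w ^ m /\<^sub>R fact m * E $$ (i, j) + (if m = 0 then ?d - E $$ (i, j) else 0)" for m
    proof (cases m)
      case 0
      thus ?thesis using E ij by simp
    next
      case (Suc m')
      have "((w \<cdot>\<^sub>m E) ^\<^sub>m m) $$ (i, j) = w ^ m * E $$ (i, j)"
        unfolding Suc pow using E ij by simp
      thus ?thesis using Suc by (simp add: scaleR_conv_of_real field_simps)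
    qed
    moreover have "(\<lambda>m. w ^ m /\<^sub>R fact m * E $$ (i, j) + (if m = 0 then ?d - E $$ (i, j) else 0))
        sums (exp w * E $$ (i, j) + (?d - E $$ (i, j)))"
      by (intro sums_add sums_mult2 exp_converges)
         (use sums_single[of 0 "\<lambda>_. ?d - E $$ (i, j)"] in simp)
    ultimately have "(\<Sum>m. ((w \<cdot>\<^sub>m E) ^\<^sub>m m) $$ (i, j) / fact m)
        = exp w * E $$ (i, j) + (?d - E $$ (i, j))"
      by (simp add: sums_iff)
    thus "mat_exp (w \<cdot>\<^sub>m E) $$ (i, j) = (1\<^sub>m n + (exp w - 1) \<cdot>\<^sub>m E) $$ (i, j)"
      using E ij by (simp add: mat_exp_def algebra_simps)
  qed (use E in \<open>auto simp: mat_exp_def\<close>)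
qed

section \<open>Block diagonal matrices\<close>

lemma lp_bounded_iff_lp_sum:
  assumes "0 < p" "0 \<le> K"
  shows "lp_bounded p K A \<longleftrightarrow>
    (\<forall>v\<in>carrier_vec (dim_col A). lp_sum p (A *\<^sub>v v) \<le> K powr p * lp_sum p v)"
  using lp_norm_le_iff[OF assms] by (simp add: lp_bounded_def)

lemma lp_bounded_diag_block_mat:
  assumes p: "0 < p" and K: "0 \<le> K"
    and As: "\<forall>A\<in>set As. square_mat A \<and> lp_bounded p K A"
  shows "lp_bounded p K (diag_block_mat As)"
  using As
proof (induction As)
  case Nil
  show ?case by (simp add: lp_bounded_iff_lp_sum[OF p K] lp_sum_def)
next
  case (Cons A As)
  define B where "B = diag_block_mat As"
  define n m where "n = dim_row A" and "m = dim_row B"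
  have A: "A \<in> carrier_mat n n" using Cons.prems by (auto simp: n_def)
  have "square_mat B" unfolding B_def using Cons.prems by (intro diag_block_mat_square) auto
  hence B: "B \<in> carrier_mat m m" by (auto simp: m_def)
  have bd: "lp_bounded p K A" "lp_bounded p K B" using Cons by (auto simp: B_def)
  have eq: "diag_block_mat (A # As) = four_block_mat A (0\<^sub>m n m) (0\<^sub>m m n) B"
    using A B by (simp add: B_def Let_def)
  show ?case
    unfolding lp_bounded_iff_lp_sum[OF p K] eq
  proof
    fix v :: "complex vec"
    assume "v \<in> carrier_vec (dim_col (four_block_mat A (0\<^sub>m n m) (0\<^sub>m m n) B))"
    hence v: "v \<in> carrier_vec (n + m)" using A B by simp
    define a b where "a = vec_first v n" and "b = vec_last v m"
    have ab: "a \<in> carrier_vec n" "b \<in> carrier_vec m" "v = a @\<^sub>v b"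
      using v by (auto simp: a_def b_def)
    have "lp_sum p (four_block_mat A (0\<^sub>m n m) (0\<^sub>m m n) B *\<^sub>v v)
        = lp_sum p (A *\<^sub>v a) + lp_sum p (B *\<^sub>v b)"
      using mult_mat_vec_split[OF A B ab(1,2)] by (simp add: ab(3) lp_sum_append)
    also have "\<dots> \<le> K powr p * lp_sum p a + K powr p * lp_sum p b"
      using bd A B ab unfolding lp_bounded_iff_lp_sum[OF p K] by (intro add_mono) auto
    also have "\<dots> = K powr p * lp_sum p v" by (simp add: ab(3) lp_sum_append algebra_simps)
    finally show "lp_sum p (four_block_mat A (0\<^sub>m n m) (0\<^sub>m m n) B *\<^sub>v v) \<le> K powr p * lp_sum p v" .
  qed
qed

lemma one_plus_smult_diag_block_mat:
  fixes As :: "complex mat list"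
  assumes "\<forall>A\<in>set As. square_mat A"
  shows "1\<^sub>m (sum_list (map dim_row As)) + w \<cdot>\<^sub>m diag_block_mat As
    = diag_block_mat (map (\<lambda>A. 1\<^sub>m (dim_row A) + w \<cdot>\<^sub>m A) As)"
  using assms
proof (induction As)
  case Nil
  show ?case by (intro eq_matI) auto
next
  case (Cons A As)
  define B where "B = diag_block_mat As"
  define n m where "n = dim_row A" and "m = dim_row B"
  have A: "A \<in> carrier_mat n n" using Cons.prems by (auto simp: n_def)
  have "square_mat B" unfolding B_def using Cons.prems by (intro diag_block_mat_square) auto
  hence B: "B \<in> carrier_mat m m" by (auto simp: m_def)
  have m: "sum_list (map dim_row As) = m" by (simp add: m_def B_def dim_diag_block_mat)
  have IH: "diag_block_mat (map (\<lambda>A. 1\<^sub>m (dim_row A) + w \<cdot>\<^sub>m A) As) = 1\<^sub>m m + w \<cdot>\<^sub>m B"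
    using Cons by (simp add: m B_def)
  have "1\<^sub>m (n + m) + w \<cdot>\<^sub>m four_block_mat A (0\<^sub>m n m) (0\<^sub>m m n) B
      = four_block_mat (1\<^sub>m n + w \<cdot>\<^sub>m A) (0\<^sub>m n m) (0\<^sub>m m n) (1\<^sub>m m + w \<cdot>\<^sub>m B)"
    using A B by (intro eq_matI) auto
  thus ?case
    using A B by (simp add: Let_def IH m n_def[symmetric] flip: B_def)
qed

text \<open>
  The rows of a block diagonal matrix whose blocks are labelled by \<open>T\<close>, in order: a row is
  identified by the label of its block and its position inside that block.
\<close>

definition block_index :: "('t \<Rightarrow> nat) \<Rightarrow> 't list \<Rightarrow> ('t \<times> nat) list" where
  "block_index m T = concat (map (\<lambda>t. map (Pair t) [0..<m t]) T)"

lemma set_block_index: "set (block_index m T) = {(t, i). t \<in> set T \<and> i < m t}"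
  by (auto simp: block_index_def)

lemma distinct_block_index: "distinct T \<Longrightarrow> distinct (block_index m T)"
proof (induction T)
  case (Cons t T)
  thus ?case using set_block_index[of m T]
    by (auto simp: block_index_def distinct_map inj_on_def)
qed (simp add: block_index_def)

lemma length_block_index: "length (block_index m T) = sum_list (map m T)"
  by (induction T) (auto simp: block_index_def)

text \<open>
  Addressing entries by label and position replaces the recursive definition of a block diagonal matrix
  and its offsets by one formula, which can be compared with a matrix product.
\<close>

lemma diag_block_mat_conv_block_index:
  fixes A :: "'t \<Rightarrow> complex mat"
  assumes "distinct T" "\<forall>t\<in>set T. A t \<in> carrier_mat (m t) (m t)"
  defines "L \<equiv> block_index m T"
  shows "diag_block_mat (map A T) = mat (length L) (length L)
    (\<lambda>(q, q'). if fst (L ! q) = fst (L ! q')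
      then A (fst (L ! q)) $$ (snd (L ! q), snd (L ! q')) else 0)"
  using assms(1,2) unfolding L_def
proof (induction T)
  case Nil
  show ?case by (intro eq_matI) (auto simp: block_index_def)
next
  case (Cons t T)
  define L where "L = block_index m T"
  define B where "B = diag_block_mat (map A T)"
  have B: "B = mat (length L) (length L) (\<lambda>(q, q'). if fst (L ! q) = fst (L ! q')
      then A (fst (L ! q)) $$ (snd (L ! q), snd (L ! q')) else 0)"
    unfolding B_def L_def using Cons by simp
  have dimB: "dim_row B = length L" "dim_col B = length L" by (simp_all add: B)
  have At: "A t \<in> carrier_mat (m t) (m t)" using Cons.prems by simp
  have split: "block_index m (t # T) = map (Pair t) [0..<m t] @ L"
    by (simp add: block_index_def L_def)
  have notin: "fst (L ! q) \<noteq> t \<and> t \<noteq> fst (L ! q)" if "q < length L" for q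
  proof -
    have "L ! q \<in> set L" using that by simp
    thus ?thesis using Cons.prems unfolding L_def set_block_index by auto
  qed
  show ?case
    unfolding split
  proof (rule eq_matI, goal_cases)
    case (1 q q')
    thus ?case
      using At notin[of "q - m t"] notin[of "q' - m t"]
      by (auto simp: Let_def nth_append dimB B[symmetric] simp flip: B_def)
         (auto simp: B)
  next
    case 2
    thus ?case using At by (simp add: Let_def dimB flip: B_def)
  next
    case 3
    thus ?case using At by (simp add: Let_def dimB flip: B_def)
  qed
qed

section \<open>Direct sums and the images of matrix units\<close>

definition mat_unit :: "nat \<Rightarrow> nat \<Rightarrow> nat \<Rightarrow> complex mat" where
  "mat_unit n i l = mat n n (\<lambda>(x, y). if x = i \<and> y = l then 1 else 0)"

lemma mat_unit_carrier [simp]: "mat_unit n i l \<in> carrier_mat n n"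
  by (simp add: mat_unit_def)

lemma mat_unit_corner:
  assumes "A \<in> carrier_mat n n" "i < n" "i' < n"
  shows "mat_unit n k i * A * mat_unit n i' k' = A $$ (i, i') \<cdot>\<^sub>m mat_unit n k k'"
proof (rule eq_matI)
  fix x y assume "x < dim_row (A $$ (i, i') \<cdot>\<^sub>m mat_unit n k k')"
    "y < dim_col (A $$ (i, i') \<cdot>\<^sub>m mat_unit n k k')"
  hence xy: "x < n" "y < n" by (simp_all add: mat_unit_def)
  have "(mat_unit n k i * A) $$ (x, z) = (if x = k then A $$ (i, z) else 0)" if "z < n" for z
    using assms xy that by (simp add: mat_unit_def scalar_prod_def if_distrib[of "\<lambda>a. a * _"]
        sum.delta cong: if_cong)
  thus "(mat_unit n k i * A * mat_unit n i' k') $$ (x, y) = (A $$ (i, i') \<cdot>\<^sub>m mat_unit n k k') $$ (x, y)"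
    using assms xy by (simp add: mat_unit_def scalar_prod_def if_distrib[of "\<lambda>a. _ * a"]
        sum.delta cong: if_cong)
qed (simp_all add: mat_unit_def)

lemma dsum_nth: "a \<in> dsum c \<Longrightarrow> j < length c \<Longrightarrow> a ! j \<in> carrier_mat (c ! j) (c ! j)"
  by (simp add: dsum_def)

lemma dsum_length: "a \<in> dsum c \<Longrightarrow> length a = length c"
  by (simp add: dsum_def)

lemma dsum_eqI:
  "a \<in> dsum c \<Longrightarrow> b \<in> dsum c \<Longrightarrow> (\<And>j. j < length c \<Longrightarrow> a ! j = b ! j) \<Longrightarrow> a = b"
  by (intro nth_equalityI) (auto simp: dsum_length)

lemma dsum_one_carrier [simp]: "dsum_one c \<in> dsum c"
  by (simp add: dsum_def dsum_one_def)

lemma dsum_add_carrier [simp]: "a \<in> dsum c \<Longrightarrow> b \<in> dsum c \<Longrightarrow> dsum_add a b \<in> dsum c"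
  by (simp add: dsum_def)

lemma dsum_mult_carrier [simp]: "a \<in> dsum c \<Longrightarrow> b \<in> dsum c \<Longrightarrow> dsum_mult a b \<in> dsum c"
  by (auto simp: dsum_def)

lemma dsum_smult_carrier [simp]: "a \<in> dsum c \<Longrightarrow> dsum_smult z a \<in> dsum c"
  by (simp add: dsum_def)

lemma dsum_incl_carrier [simp]:
  "x \<in> carrier_mat (c ! j) (c ! j) \<Longrightarrow> dsum_incl c j x \<in> dsum c"
  by (cases "j < length c") (auto simp: dsum_def dsum_incl_def nth_list_update)

lemma dsum_incl_nth:
  "j < length c \<Longrightarrow> k < length c \<Longrightarrow>
     dsum_incl c j x ! k = (if k = j then x else 0\<^sub>m (c ! k) (c ! k))"
  by (simp add: dsum_incl_def nth_list_update)

lemma dsum_mult_one [simp]: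
  assumes "a \<in> dsum c"
  shows "dsum_mult a (dsum_one c) = a" "dsum_mult (dsum_one c) a = a"
proof -
  have "dsum_mult a (dsum_one c) ! j = a ! j" "dsum_mult (dsum_one c) a ! j = a ! j"
    if "j < length c" for j
    using that dsum_nth[OF assms that] dsum_length[OF assms] by (simp_all add: dsum_one_def)
  thus "dsum_mult a (dsum_one c) = a" "dsum_mult (dsum_one c) a = a"
    using assms by (auto intro!: dsum_eqI[of _ c])
qed

lemma dsum_incl_corner:
  assumes a: "a \<in> dsum c" and j: "j < length c" "j' < length c" and i: "i < c ! j" "i' < c ! j'"
  shows "dsum_mult (dsum_mult (dsum_incl c j (mat_unit (c ! j) k i)) a)
      (dsum_incl c j' (mat_unit (c ! j') i' k')) =
    (if j = j' then dsum_smult (a ! j $$ (i, i')) (dsum_incl c j (mat_unit (c ! j) k k'))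
     else dsum_smult 0 (dsum_one c))"
proof (rule dsum_eqI[of _ c])
  show "dsum_mult (dsum_mult (dsum_incl c j (mat_unit (c ! j) k i)) a)
      (dsum_incl c j' (mat_unit (c ! j') i' k')) \<in> dsum c"
    using a by (intro dsum_mult_carrier dsum_incl_carrier) simp_all
  show "(if j = j' then dsum_smult (a ! j $$ (i, i')) (dsum_incl c j (mat_unit (c ! j) k k'))
     else dsum_smult 0 (dsum_one c)) \<in> dsum c"
    by simp
  fix m assume m: "m < length c"
  let ?u = "dsum_incl c j (mat_unit (c ! j) k i)" and ?v = "dsum_incl c j' (mat_unit (c ! j') i' k')"
  have len: "length ?u = length c" "length ?v = length c" "length a = length c"
    using a by (simp_all add: dsum_incl_def dsum_length)
  have am: "a ! m \<in> carrier_mat (c ! m) (c ! m)" using a m by (rule dsum_nth)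
  have "dsum_mult (dsum_mult ?u a) ?v ! m = ?u ! m * a ! m * ?v ! m"
    using m by (simp add: len)
  also have "\<dots> = (if m = j \<and> m = j' then a ! j $$ (i, i') \<cdot>\<^sub>m mat_unit (c ! j) k k'
      else 0\<^sub>m (c ! m) (c ! m))"
    using m j i mat_unit_corner[OF am, of i i' k k'] carrier_matD[OF am]
      carrier_matD[OF mat_unit_carrier[of "c ! m"]]
      left_mult_zero_mat[OF mat_unit_carrier[of "c ! m" i' k']]
    by (auto simp: dsum_incl_nth)
  also have "\<dots> = (if j = j' then dsum_smult (a ! j $$ (i, i')) (dsum_incl c j (mat_unit (c ! j) k k'))
     else dsum_smult 0 (dsum_one c)) ! m"
    using m j len(1)
    by (auto simp: dsum_incl_nth dsum_one_def dsum_incl_def intro!: eq_matI)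
  finally show "dsum_mult (dsum_mult ?u a) ?v ! m = \<dots>" .
qed

definition dsum_diag :: "nat list \<Rightarrow> (nat \<times> nat) set \<Rightarrow> complex mat list" where
  "dsum_diag c X = map (\<lambda>j. coord_proj (c ! j) {i. (j, i) \<in> X}) [0..<length c]"

text \<open>
  A possibly nonunital homomorphism from a direct sum into a single matrix algebra. Sizes are positive so
  that every summand has the matrix units with an index \<open>0\<close>.
\<close>

locale dsum_mat_hom =
  fixes c :: "nat list" and n :: nat and \<rho> :: "complex mat list \<Rightarrow> complex mat"
  assumes size_pos: "\<And>j. j < length c \<Longrightarrow> 0 < c ! j"
    and hom_carrier [simp]: "a \<in> dsum c \<Longrightarrow> \<rho> a \<in> carrier_mat n n"
    and hom_add: "a \<in> dsum c \<Longrightarrow> b \<in> dsum c \<Longrightarrow> \<rho> (dsum_add a b) = \<rho> a + \<rho> b"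
    and hom_smult: "a \<in> dsum c \<Longrightarrow> \<rho> (dsum_smult z a) = z \<cdot>\<^sub>m \<rho> a"
    and hom_mult: "a \<in> dsum c \<Longrightarrow> b \<in> dsum c \<Longrightarrow> \<rho> (dsum_mult a b) = \<rho> a * \<rho> b"
begin

definition unit_image :: "nat \<Rightarrow> nat \<Rightarrow> nat \<Rightarrow> complex mat" where
  "unit_image j k i = \<rho> (dsum_incl c j (mat_unit (c ! j) k i))"

lemma unit_image_carrier [simp]: "unit_image j k i \<in> carrier_mat n n"
  by (simp add: unit_image_def)

text \<open>
  Compressing \<open>\<rho>(a)\<close> between images of matrix units extracts one entry of \<open>a\<close>, because
  \<open>e(k,i) a e(i',k')\<close> is that entry times \<open>e(k,k')\<close>.
\<close>

lemma unit_image_corner: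
  assumes "a \<in> dsum c" "j < length c" "j' < length c" "i < c ! j" "i' < c ! j'"
  shows "unit_image j k i * \<rho> a * unit_image j' i' k' =
    (if j = j' then a ! j $$ (i, i') \<cdot>\<^sub>m unit_image j k k' else 0\<^sub>m n n)"
proof -
  have "unit_image j k i * \<rho> a * unit_image j' i' k' =
      \<rho> (dsum_mult (dsum_mult (dsum_incl c j (mat_unit (c ! j) k i)) a)
        (dsum_incl c j' (mat_unit (c ! j') i' k')))"
    using assms by (simp add: unit_image_def hom_mult)
  also have "\<dots> = (if j = j' then a ! j $$ (i, i') \<cdot>\<^sub>m unit_image j k k' else 0 \<cdot>\<^sub>m \<rho> (dsum_one c))"
    unfolding dsum_incl_corner[OF assms] by (simp add: unit_image_def hom_smult)
  also have "0 \<cdot>\<^sub>m \<rho> (dsum_one c) = 0\<^sub>m n n"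
    using carrier_matD[OF hom_carrier[OF dsum_one_carrier]] by (intro eq_matI) auto
  finally show ?thesis .
qed

lemma unit_image_mult:
  assumes "j < length c" "j' < length c" "i < c ! j" "i' < c ! j'"
  shows "unit_image j k i * unit_image j' i' k' =
    (if j = j' \<and> i = i' then unit_image j k k' else 0\<^sub>m n n)"
proof -
  have "unit_image j k i = unit_image j k i * \<rho> (dsum_one c)"
    by (simp add: unit_image_def flip: hom_mult)
  hence "unit_image j k i * unit_image j' i' k' =
      unit_image j k i * \<rho> (dsum_one c) * unit_image j' i' k'" by simp
  also have "\<dots> = (if j = j' \<and> i = i' then unit_image j k k' else 0\<^sub>m n n)"
    unfolding unit_image_corner[OF dsum_one_carrier assms]
    using assms carrier_matD[OF unit_image_carrier] by (auto simp: dsum_one_def intro!: eq_matI)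
  finally show ?thesis .
qed

text \<open>
  Additivity over finite sums, stated entrywise because matrices of unspecified size form no additive
  monoid. Only sums of diagonal matrix units occur.
\<close>

lemma sum_unit_image_diag:
  assumes "finite X" "X \<subseteq> {(j, i). j < length c \<and> i < c ! j}" and xy: "x < n" "y < n"
  shows "(\<Sum>(j, i)\<in>X. unit_image j i i $$ (x, y)) = \<rho> (dsum_diag c X) $$ (x, y)"
  using assms(1,2)
proof (induction X)
  case empty
  have "dsum_diag c {} = dsum_smult 0 (dsum_one c)"
    by (intro dsum_eqI[of _ c]) (auto simp: dsum_diag_def coord_proj_def dsum_one_def dsum_def)
  thus ?case using carrier_matD[OF hom_carrier[OF dsum_one_carrier]] xy by (simp add: hom_smult)
next
  case (insert t X)
  obtain j i where t: "t = (j, i)" by (cases t)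
  have ji: "j < length c" "i < c ! j" using insert.prems t by auto
  have carr: "dsum_diag c Y \<in> dsum c" for Y by (simp add: dsum_diag_def dsum_def coord_proj_def)
  have "dsum_diag c (insert t X) = dsum_add (dsum_incl c j (mat_unit (c ! j) i i)) (dsum_diag c X)"
  proof (rule dsum_eqI[of _ c])
    fix k assume k: "k < length c"
    have "dsum_diag c (insert t X) ! k =
        dsum_incl c j (mat_unit (c ! j) i i) ! k + dsum_diag c X ! k"
      using k ji insert.hyps
      by (intro eq_matI) (auto simp: dsum_incl_nth dsum_diag_def coord_proj_def mat_unit_def t)
    thus "dsum_diag c (insert t X) ! k =
        dsum_add (dsum_incl c j (mat_unit (c ! j) i i)) (dsum_diag c X) ! k"
      using k dsum_length[OF carr] by (simp add: dsum_incl_def)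
  qed (simp_all add: carr)
  hence "\<rho> (dsum_diag c (insert t X)) = unit_image j i i + \<rho> (dsum_diag c X)"
    by (simp add: hom_add carr unit_image_def)
  thus ?case
    using insert xy hom_carrier[OF carr] carrier_matD[OF hom_carrier[OF carr]] by (simp add: t)
qed

definition diag_positions :: "(nat \<times> nat) set" where
  "diag_positions = (SIGMA j:{..<length c}. {..<c ! j})"

lemma sum_unit_image:
  assumes "x < n" "y < n"
  shows "(\<Sum>(j, i)\<in>diag_positions. unit_image j i i $$ (x, y)) = \<rho> (dsum_one c) $$ (x, y)"
proof -
  have "dsum_diag c diag_positions = dsum_one c"
    by (intro dsum_eqI[of _ c])
       (auto simp: dsum_diag_def coord_proj_def dsum_one_def dsum_def diag_positions_def intro!: eq_matI)
  thus ?thesis using assms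
    by (subst sum_unit_image_diag) (auto simp: diag_positions_def)
qed

end

section \<open>Block diagonalization of contractive unital homomorphisms\<close>

lemma sum_distinct_nth:
  assumes "distinct xs"
  shows "(\<Sum>q<length xs. f (xs ! q)) = sum f (set xs)"
  using sum.reindex_bij_betw[OF bij_betw_nth[OF assms refl refl], of f] by simp

text \<open>
  Both products have the same trace.
\<close>

lemma dim_eq_if_inverse:
  fixes A :: "'a :: field_char_0 mat"
  assumes A: "A \<in> carrier_mat m n" and B: "B \<in> carrier_mat n m"
    and AB: "A * B = 1\<^sub>m m" and BA: "B * A = 1\<^sub>m n"
  shows "m = n"
proof -
  have "of_nat m = (\<Sum>i<m. (A * B) $$ (i, i))" by (simp add: AB)
  also have "\<dots> = (\<Sum>i<m. \<Sum>j<n. A $$ (i, j) * B $$ (j, i))"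
    using A B by (simp add: scalar_prod_def atLeast0LessThan)
  also have "\<dots> = (\<Sum>j<n. \<Sum>i<m. B $$ (j, i) * A $$ (i, j))"
    by (subst sum.swap) (simp add: mult.commute)
  also have "\<dots> = (\<Sum>j<n. (B * A) $$ (j, j))"
    using A B by (simp add: scalar_prod_def atLeast0LessThan)
  also have "\<dots> = (of_nat n :: 'a)" by (simp add: BA)
  finally show ?thesis by simp
qed

lemma coord_proj_mult_vec:
  "v \<in> carrier_vec n \<Longrightarrow> i < n \<Longrightarrow> (coord_proj n S *\<^sub>v v) $ i = (if i \<in> S then v $ i else 0)"
  by (simp add: coord_proj_def scalar_prod_def if_distrib[of "\<lambda>a. a * _"] cong: if_cong)

lemma coord_proj_mult_nth:
  "A \<in> carrier_mat n m \<Longrightarrow> i < n \<Longrightarrow> j < m \<Longrightarrow>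
     (coord_proj n S * A) $$ (i, j) = (if i \<in> S then A $$ (i, j) else 0)"
  by (simp add: coord_proj_def scalar_prod_def if_distrib[of "\<lambda>a. a * _"] cong: if_cong)

text \<open>
  The situation reached when the images of the diagonal matrix units are known to be coordinate
  projections.
\<close>

locale contractive_unital_hom = dsum_mat_hom +
  fixes p :: real and S :: "nat \<Rightarrow> nat \<Rightarrow> nat set"
  assumes p_pos: "0 < p"
    and unital: "\<rho> (dsum_one c) = 1\<^sub>m n"
    and unit_image_contraction:
      "\<And>j k i. j < length c \<Longrightarrow> k < c ! j \<Longrightarrow> i < c ! j \<Longrightarrow> lp_contraction p (unit_image j k i)"
    and unit_image_diag:
      "\<And>j i. j < length c \<Longrightarrow> i < c ! j \<Longrightarrow> unit_image j i i = coord_proj n (S j i)"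
    and support_subset: "\<And>j i. S j i \<subseteq> {..<n}"
begin

lemma finite_support [simp]: "finite (S j i)"
  using support_subset finite_subset by blast

lemma unit_image_row_zero:
  assumes "j < length c" "i < c ! j" "x < n" "y < n" "x \<notin> S j 0"
  shows "unit_image j 0 i $$ (x, y) = 0"
proof -
  have "unit_image j 0 i = coord_proj n (S j 0) * unit_image j 0 i"
    using assms size_pos by (simp add: unit_image_mult flip: unit_image_diag)
  hence "unit_image j 0 i $$ (x, y) = (coord_proj n (S j 0) * unit_image j 0 i) $$ (x, y)"
    by (rule arg_cong)
  also have "\<dots> = 0" using assms by (simp add: coord_proj_mult_nth[OF unit_image_carrier])
  finally show ?thesis .
qed

text \<open>
  The sets \<open>S j i\<close> partition the coordinates: the diagonal entries at \<open>y\<close> of the projections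
  \<open>unit_image j i i\<close> are \<open>0\<close> or \<open>1\<close> and add up to \<open>1\<close>.
\<close>

lemma sum_over_supports:
  fixes t :: real
  assumes "y < n"
  shows "(\<Sum>(j, i)\<in>diag_positions. if y \<in> S j i then t else 0) = t"
proof -
  let ?X = "{w \<in> diag_positions. y \<in> S (fst w) (snd w)}"
  have count: "(\<Sum>(j, i)\<in>diag_positions. if y \<in> S j i then u else 0) = of_nat (card ?X) * u"
    for u :: "'c :: real_algebra_1"
  proof -
    have "finite diag_positions" by (simp add: diag_positions_def)
    from sum.inter_filter[OF this, of "\<lambda>_. u" "\<lambda>w. y \<in> S (fst w) (snd w)"]
    show ?thesis unfolding split_def by (simp only: sum_constant)
  qed
  have "1 = (\<Sum>(j, i)\<in>diag_positions. unit_image j i i $$ (y, y))"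
    using assms unfolding sum_unit_image[OF assms assms] unital by simp
  also have "\<dots> = (\<Sum>(j, i)\<in>diag_positions. if y \<in> S j i then 1 else 0)"
  proof (intro sum.cong refl, clarify)
    fix j i assume "(j, i) \<in> diag_positions"
    hence "j < length c" "i < c ! j" by (auto simp: diag_positions_def)
    thus "unit_image j i i $$ (y, y) = (if y \<in> S j i then 1 else 0)"
      using assms by (simp only: unit_image_diag) (simp add: coord_proj_def)
  qed
  also have "\<dots> = of_nat (card ?X) * 1" by (rule count)
  finally have "(of_nat 1 :: complex) = of_nat (card ?X)" by (simp only: mult_1_right of_nat_1)
  hence "card ?X = 1" by (simp only: of_nat_eq_iff)
  thus ?thesis unfolding count by (simp only: of_nat_1 mult_1_left)
qed

text \<open>
  The contractions \<open>unit_image j 0 i\<close> and \<open>unit_image j i 0\<close> undo each other between the ranges of the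
  projections onto \<open>S j 0\<close> and \<open>S j i\<close>, so \<open>unit_image j 0 i\<close> preserves the norm of the part of \<open>v\<close>
  that lives on \<open>S j i\<close>.
\<close>

lemma lp_sum_unit_image:
  assumes "j < length c" "i < c ! j" and v: "v \<in> carrier_vec n"
  shows "lp_sum p (unit_image j 0 i *\<^sub>v v) = (\<Sum>y<n. if y \<in> S j i then cmod (v $ y) powr p else 0)"
proof -
  have contr: "lp_sum p (unit_image j k l *\<^sub>v w) \<le> lp_sum p w"
    if "k < c ! j" "l < c ! j" "w \<in> carrier_vec n" for k l w
    using that unit_image_contraction[OF assms(1) that(1,2)]
    by (simp add: lp_contraction_iff[OF p_pos] carrier_matD[OF unit_image_carrier])
  have step: "unit_image j k l *\<^sub>v (unit_image j l l' *\<^sub>v v) = unit_image j k l' *\<^sub>v v"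
    if "l < c ! j" for k l l'
  proof -
    have "unit_image j k l * unit_image j l l' = unit_image j k l'"
      using that assms by (simp add: unit_image_mult)
    thus ?thesis using v by (metis assoc_mult_mat_vec unit_image_carrier)
  qed
  have pos: "0 < c ! j" using assms size_pos by simp
  have carr: "unit_image j k l *\<^sub>v v \<in> carrier_vec n" for k l
    by (intro carrier_vecI) (simp add: carrier_matD[OF unit_image_carrier])
  have "lp_sum p (unit_image j 0 i *\<^sub>v v) = lp_sum p (unit_image j i i *\<^sub>v v)"
  proof (rule antisym)
    show "lp_sum p (unit_image j 0 i *\<^sub>v v) \<le> lp_sum p (unit_image j i i *\<^sub>v v)"
      using contr[OF pos assms(2) carr[of i i]] step[OF assms(2), of 0 i] by simp
    show "lp_sum p (unit_image j i i *\<^sub>v v) \<le> lp_sum p (unit_image j 0 i *\<^sub>v v)"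
      using contr[OF assms(2) pos carr[of 0 i]] step[OF pos, of i i] by simp
  qed
  also have "\<dots> = (\<Sum>y<n. cmod (if y \<in> S j i then v $ y else 0) powr p)"
    using assms coord_proj_mult_vec[OF v]
    by (simp add: unit_image_diag lp_sum_def) (simp add: coord_proj_def)
  also have "\<dots> = (\<Sum>y<n. if y \<in> S j i then cmod (v $ y) powr p else 0)"
    by (intro sum.cong) auto
  finally show ?thesis .
qed

text \<open>
  There is one block \<open>a\<^sub>j\<close> for every pair \<open>(j, x)\<close> with \<open>x\<close> in \<open>S j 0\<close>, so the rows of the block diagonal
  matrix are indexed by triples \<open>((j, x), i)\<close>. Row \<open>((j, x), i)\<close> of \<open>s\<close> is row \<open>x\<close> of \<open>unit_image j 0 i\<close>,
  and the corresponding column of \<open>s'\<close> is column \<open>x\<close> of \<open>unit_image j i 0\<close>. Hence an entry of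
  \<open>s * Y * s'\<close> is an entry of \<open>unit_image j 0 i * Y * unit_image j' i' 0\<close>, and the multiplication rules
  for matrix units evaluate the latter for \<open>Y = \<rho> a\<close>. That the number of triples is \<open>n\<close> follows from
  \<open>s\<close> and \<open>s'\<close> being inverse to each other.
\<close>

lemma isometry_to_block_diagonal:
  obtains r s s' where "set r \<subseteq> {..<length c}" "(\<Sum>k\<leftarrow>r. c ! k) = n"
    "s \<in> carrier_mat n n" "s' \<in> carrier_mat n n" "s * s' = 1\<^sub>m n" "s' * s = 1\<^sub>m n"
    "lp_contraction p s" "lp_contraction p s'"
    "\<forall>a\<in>dsum c. s * \<rho> a * s' = diag_block_mat (map (\<lambda>k. a ! k) r)"
proof -
  have "finite (SIGMA j:{..<length c}. S j 0)"
    by (intro finite_SigmaI finite_lessThan finite_support)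
  from finite_distinct_list[OF this]
  obtain T where T: "set T = (SIGMA j:{..<length c}. S j 0)" "distinct T"
    by (elim exE conjE)
  define r where "r = map fst T"
  define L where "L = block_index (\<lambda>t. c ! fst t) T"
  define N where "N = length L"
  have L: "distinct L" "set L = {((j, x), i). j < length c \<and> x \<in> S j 0 \<and> i < c ! j}"
    unfolding L_def using T(2) by (simp_all add: set_block_index T(1) distinct_block_index) auto
  have N: "(\<Sum>k\<leftarrow>r. c ! k) = N"
    by (simp add: N_def L_def length_block_index r_def o_def)
  define J X I where "J q = fst (fst (L ! q))" and "X q = snd (fst (L ! q))" and "I q = snd (L ! q)" for q
  have q: "J q < length c" "X q \<in> S (J q) 0" "I q < c ! J q" "X q < n" if "q < N" for q
  proof -
    have "L ! q \<in> set L" using that by (simp add: N_def)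
    thus "J q < length c" "X q \<in> S (J q) 0" "I q < c ! J q" unfolding L J_def X_def I_def by auto
    thus "X q < n" using support_subset by blast
  qed
  have sum_L: "(\<Sum>q<N. f (J q) (I q) (X q)) = (\<Sum>(j, i)\<in>diag_positions. \<Sum>x\<in>S j 0. f j i x)"
    for f :: "nat \<Rightarrow> nat \<Rightarrow> nat \<Rightarrow> 'c :: comm_monoid_add"
  proof -
    have "(\<Sum>q<N. f (J q) (I q) (X q)) = (\<Sum>((j, x), i)\<in>set L. f j i x)"
      unfolding N_def sum_distinct_nth[OF L(1), symmetric]
      by (intro sum.cong) (auto simp: J_def I_def X_def split: prod.splits)
    also have "\<dots> = (\<Sum>((j, i), x)\<in>(SIGMA t:diag_positions. S (fst t) 0). f j i x)"
      by (rule sum.reindex_bij_witness[of _ "\<lambda>((j, i), x). ((j, x), i)" "\<lambda>((j, x), i). ((j, i), x)"])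
         (auto simp: L diag_positions_def)
    also have "\<dots> = (\<Sum>(j, i)\<in>diag_positions. \<Sum>x\<in>S j 0. f j i x)"
      by (subst sum.Sigma[symmetric]) (auto simp: diag_positions_def split_def)
    finally show ?thesis .
  qed
  have full: "(\<Sum>x\<in>S j 0. g x) = (\<Sum>x<n. g x)" if "\<And>x. x < n \<Longrightarrow> x \<notin> S j 0 \<Longrightarrow> g x = 0"
    for g :: "nat \<Rightarrow> 'c :: comm_monoid_add" and j
    using support_subset[of j 0] that by (intro sum.mono_neutral_left) auto
  define s where "s = mat N n (\<lambda>(q, y). unit_image (J q) 0 (I q) $$ (X q, y))"
  define s' where "s' = mat n N (\<lambda>(y, q). unit_image (J q) (I q) 0 $$ (y, X q))"
  have s: "s \<in> carrier_mat N n" "s' \<in> carrier_mat n N" by (auto simp: s_def s'_def)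
  have dims: "dim_row (unit_image j k i) = n" "dim_col (unit_image j k i) = n" for j k i
    using carrier_matD[OF unit_image_carrier] by auto
  have row_s: "row s q = row (unit_image (J q) 0 (I q)) (X q)" if "q < N" for q
    using that q[OF that] by (intro eq_vecI) (auto simp: s_def dims)
  have col_s': "col s' q = col (unit_image (J q) (I q) 0) (X q)" if "q < N" for q
    using that q[OF that] by (intro eq_vecI) (auto simp: s'_def dims)
  have corner: "(s * Y * s') $$ (q, q') =
      (unit_image (J q) 0 (I q) * Y * unit_image (J q') (I q') 0) $$ (X q, X q')"
    if Y: "Y \<in> carrier_mat n n" and qq: "q < N" "q' < N" for Y q q'
    using s Y qq q[OF qq(1)] q[OF qq(2)] row_mult[OF s(1) Y] row_mult[OF unit_image_carrier Y]
    by (simp add: row_s col_s' dims del: assoc_mult_mat)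
  have corner_00: "unit_image j 0 0 $$ (x, x') = (if x = x' then 1 else 0)"
    if "j < length c" "x \<in> S j 0" "x' \<in> S j 0" for j x x'
  proof -
    have "x < n" "x' < n" using that support_subset by blast+
    thus ?thesis using that size_pos by (simp add: unit_image_diag coord_proj_def)
  qed
  have hom_entry: "(s * \<rho> a * s') $$ (q, q') =
      (if fst (L ! q) = fst (L ! q') then a ! J q $$ (I q, I q') else 0)"
    if a: "a \<in> dsum c" and qq: "q < N" "q' < N" for a q q'
  proof -
    note q1 = q[OF qq(1)] and q2 = q[OF qq(2)]
    have "(s * \<rho> a * s') $$ (q, q') =
        (if J q = J q' then a ! J q $$ (I q, I q') * unit_image (J q) 0 0 $$ (X q, X q') else 0)"
      unfolding corner[OF hom_carrier[OF a] qq] unit_image_corner[OF a q1(1) q2(1) q1(3) q2(3)]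
      using q1 q2 by (simp add: dims)
    also have "\<dots> = (if J q = J q' \<and> X q = X q' then a ! J q $$ (I q, I q') else 0)"
      using corner_00[OF q1(1,2), of "X q'"] q2(2) by auto
    also have "J q = J q' \<and> X q = X q' \<longleftrightarrow> fst (L ! q) = fst (L ! q')"
      by (auto simp: J_def X_def prod_eq_iff)
    finally show ?thesis .
  qed
  have block: "s * \<rho> a * s' = diag_block_mat (map (\<lambda>k. a ! k) r)" if a: "a \<in> dsum c" for a
  proof -
    have "diag_block_mat (map (\<lambda>k. a ! k) r) = diag_block_mat (map (\<lambda>t. a ! fst t) T)"
      by (simp add: r_def o_def)
    also have "\<dots> = mat N N (\<lambda>(q, q'). if fst (L ! q) = fst (L ! q')
        then a ! fst (fst (L ! q)) $$ (snd (L ! q), snd (L ! q')) else 0)"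
      unfolding N_def L_def using T a
      by (intro diag_block_mat_conv_block_index) (auto simp: dsum_def)
    also have "\<dots> = s * \<rho> a * s'"
      using s by (intro eq_matI) (auto simp: hom_entry[OF a] J_def I_def simp del: index_mult_mat(1))
    finally show ?thesis by simp
  qed
  have ss': "s * s' = 1\<^sub>m N"
  proof -
    have "s * s' = s * \<rho> (dsum_one c) * s'" using s by (simp add: unital)
    also have "\<dots> = 1\<^sub>m N"
    proof (rule eq_matI)
      fix k l assume "k < dim_row (1\<^sub>m N)" "l < dim_col (1\<^sub>m N)"
      hence kl: "k < N" "l < N" by auto
      have "k = l \<longleftrightarrow> L ! k = L ! l"
        using kl L(1) by (simp add: N_def nth_eq_iff_index_eq)
      hence "k = l \<longleftrightarrow> fst (L ! k) = fst (L ! l) \<and> I k = I l"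
        by (simp add: I_def prod_eq_iff)
      moreover have "I l < c ! J k" if "fst (L ! k) = fst (L ! l)"
        using that q(3)[OF kl(2)] by (simp add: J_def)
      ultimately show "(s * \<rho> (dsum_one c) * s') $$ (k, l) = 1\<^sub>m N $$ (k, l)"
        unfolding hom_entry[OF dsum_one_carrier kl]
        using kl q[OF kl(1)] by (auto simp: dsum_one_def)
    qed (use s in auto)
    finally show ?thesis .
  qed
  have s's: "s' * s = 1\<^sub>m n"
  proof (rule eq_matI)
    fix y z assume "y < dim_row (1\<^sub>m n)" "z < dim_col (1\<^sub>m n)"
    hence yz: "y < n" "z < n" by auto
    have "(s' * s) $$ (y, z) =
        (\<Sum>q<N. unit_image (J q) (I q) 0 $$ (y, X q) * unit_image (J q) 0 (I q) $$ (X q, z))"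
      using yz by (simp add: s_def s'_def scalar_prod_def atLeast0LessThan)
    also have "\<dots> = (\<Sum>(j, i)\<in>diag_positions. \<Sum>x\<in>S j 0. unit_image j i 0 $$ (y, x) * unit_image j 0 i $$ (x, z))"
      by (rule sum_L)
    \<comment> \<open>The inner sum extends to all \<open>x < n\<close>, as the rows of \<open>unit_image j 0 i\<close> outside \<open>S j 0\<close> vanish.\<close>
    also have "\<dots> = (\<Sum>(j, i)\<in>diag_positions. unit_image j i i $$ (y, z))"
    proof (intro sum.cong refl, clarify)
      fix j i assume ji: "(j, i) \<in> diag_positions"
      hence ji: "j < length c" "i < c ! j" by (auto simp: diag_positions_def)
      have "(\<Sum>x\<in>S j 0. unit_image j i 0 $$ (y, x) * unit_image j 0 i $$ (x, z)) =
          (\<Sum>x<n. unit_image j i 0 $$ (y, x) * unit_image j 0 i $$ (x, z))"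
        using unit_image_row_zero[OF ji] yz by (intro full) simp
      also have "\<dots> = (unit_image j i 0 * unit_image j 0 i) $$ (y, z)"
        using yz by (simp add: dims scalar_prod_def atLeast0LessThan)
      also have "\<dots> = unit_image j i i $$ (y, z)"
        using ji size_pos by (simp add: unit_image_mult)
      finally show "(\<Sum>x\<in>S j 0. unit_image j i 0 $$ (y, x) * unit_image j 0 i $$ (x, z)) =
        unit_image j i i $$ (y, z)" .
    qed
    also have "\<dots> = 1\<^sub>m n $$ (y, z)" by (simp only: sum_unit_image[OF yz] unital)
    finally show "(s' * s) $$ (y, z) = 1\<^sub>m n $$ (y, z)" .
  qed (use s in auto)
  have Nn: "N = n" by (rule dim_eq_if_inverse[OF s ss' s's])
  have iso: "lp_sum p (s *\<^sub>v v) = lp_sum p v" if v: "v \<in> carrier_vec n" for v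
  proof -
    have "lp_sum p (s *\<^sub>v v) = (\<Sum>q<N. cmod ((unit_image (J q) 0 (I q) *\<^sub>v v) $ X q) powr p)"
      using s q by (auto simp: lp_sum_def row_s dims intro!: sum.cong)
    also have "\<dots> = (\<Sum>(j, i)\<in>diag_positions. \<Sum>x\<in>S j 0. cmod ((unit_image j 0 i *\<^sub>v v) $ x) powr p)"
      by (rule sum_L)
    also have "\<dots> = (\<Sum>(j, i)\<in>diag_positions. lp_sum p (unit_image j 0 i *\<^sub>v v))"
    proof (intro sum.cong refl, clarify)
      fix j i assume ji: "(j, i) \<in> diag_positions"
      hence ji: "j < length c" "i < c ! j" by (auto simp: diag_positions_def)
      have "(unit_image j 0 i *\<^sub>v v) $ x = 0" if "x < n" "x \<notin> S j 0" for x
        using that v unit_image_row_zero[OF ji that(1) _ that(2)]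
        by (simp add: dims scalar_prod_def)
      thus "(\<Sum>x\<in>S j 0. cmod ((unit_image j 0 i *\<^sub>v v) $ x) powr p) = lp_sum p (unit_image j 0 i *\<^sub>v v)"
        unfolding lp_sum_def dim_mult_mat_vec dims by (intro full) simp
    qed
    also have "\<dots> = (\<Sum>(j, i)\<in>diag_positions. \<Sum>y<n. if y \<in> S j i then cmod (v $ y) powr p else 0)"
      using v by (intro sum.cong) (auto simp: diag_positions_def lp_sum_unit_image)
    \<comment> \<open>Each coordinate \<open>y\<close> lies in exactly one \<open>S j i\<close>.\<close>
    also have "\<dots> = (\<Sum>y<n. \<Sum>(j, i)\<in>diag_positions. if y \<in> S j i then cmod (v $ y) powr p else 0)"
      unfolding split_def by (rule sum.swap)
    also have "\<dots> = (\<Sum>y<n. cmod (v $ y) powr p)" by (simp add: sum_over_supports)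
    also have "\<dots> = lp_sum p v" using v by (simp add: lp_sum_def)
    finally show ?thesis .
  qed
  have contr: "lp_contraction p s" using s iso by (simp add: lp_contraction_iff[OF p_pos])
  have contr': "lp_contraction p s'"
    unfolding lp_contraction_iff[OF p_pos]
  proof
    fix w :: "complex vec" assume "w \<in> carrier_vec (dim_col s')"
    hence w: "w \<in> carrier_vec N" using s by simp
    have "lp_sum p (s' *\<^sub>v w) = lp_sum p (s *\<^sub>v (s' *\<^sub>v w))" using s w by (intro iso[symmetric]) auto
    also have "s *\<^sub>v (s' *\<^sub>v w) = w" using s w ss' by (metis assoc_mult_mat_vec one_mult_mat_vec)
    finally show "lp_sum p (s' *\<^sub>v w) \<le> lp_sum p w" by simp
  qed
  show thesis
    by (rule that[of r s s']) (use s ss' s's Nn N contr contr' block T in \<open>auto simp: r_def\<close>)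
qed

end

section \<open>Images of diagonal matrix units are coordinate projections\<close>

lemma lp_sum_mono:
  assumes "dim_vec u = dim_vec v" "\<And>i. i < dim_vec v \<Longrightarrow> cmod (u $ i) \<le> cmod (v $ i)" "0 < p"
  shows "lp_sum p u \<le> lp_sum p v"
  unfolding lp_sum_def using assms by (auto intro!: sum_mono powr_mono2)

lemma lp_contraction_coord_proj: "0 < p \<Longrightarrow> lp_contraction p (coord_proj n S)"
  unfolding lp_contraction_iff
proof
  fix v :: "complex vec" assume p: "0 < p" and "v \<in> carrier_vec (dim_col (coord_proj n S))"
  hence v: "v \<in> carrier_vec n" by (simp add: coord_proj_def)
  show "lp_sum p (coord_proj n S *\<^sub>v v) \<le> lp_sum p v"
    using v p by (intro lp_sum_mono) (auto simp: coord_proj_mult_vec, simp add: coord_proj_def)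
qed

lemma mat_unit_dim [simp]: "dim_row (mat_unit n i l) = n" "dim_col (mat_unit n i l) = n"
  by (simp_all add: mat_unit_def)

lemma mat_unit_mult_vec:
  assumes "v \<in> carrier_vec n" "l < n" "x < n"
  shows "(mat_unit n i l *\<^sub>v v) $ x = (if x = i then v $ l else 0)"
  using assms
  by (simp add: mat_unit_def scalar_prod_def if_distrib[of "\<lambda>a. a * _"] cong: if_cong)

lemma one_plus_smult_mult_vec:
  fixes A :: "complex mat"
  assumes A: "A \<in> carrier_mat n n" and v: "v \<in> carrier_vec n" and y: "y < n"
  shows "((1\<^sub>m n + w \<cdot>\<^sub>m A) *\<^sub>v v) $ y = v $ y + w * (A *\<^sub>v v) $ y"
proof -
  have "(1\<^sub>m n + w \<cdot>\<^sub>m A) *\<^sub>v v = 1\<^sub>m n *\<^sub>v v + (w \<cdot>\<^sub>m A) *\<^sub>v v"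
    using A v by (intro add_mult_distrib_mat_vec) auto
  thus ?thesis using y A v by simp
qed

lemma lp_contraction_mat_unit:
  assumes p: "0 < p" and l: "l < n"
  shows "lp_contraction p (mat_unit n i l)"
  unfolding lp_contraction_iff[OF p]
proof
  fix v :: "complex vec" assume "v \<in> carrier_vec (dim_col (mat_unit n i l))"
  hence v: "v \<in> carrier_vec n" by (simp add: mat_unit_def)
  have "lp_sum p (mat_unit n i l *\<^sub>v v) = (\<Sum>x<n. if x = i then cmod (v $ l) powr p else 0)"
    unfolding lp_sum_def dim_mult_mat_vec mat_unit_dim using v l
    by (intro sum.cong) (simp_all add: mat_unit_mult_vec del: index_mult_mat_vec)
  also have "\<dots> \<le> cmod (v $ l) powr p" by (simp add: sum.delta)
  also have "\<dots> \<le> lp_sum p v" unfolding lp_sum_def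
    by (rule member_le_sum) (use l v in auto)
  finally show "lp_sum p (mat_unit n i l *\<^sub>v v) \<le> lp_sum p v" .
qed

lemma lp_hermitian_mat_unit:
  assumes p: "0 < p" and i: "i < n"
  shows "lp_hermitian p n (mat_unit n i i)"
  unfolding lp_hermitian_def lp_contraction_iff[OF p]
proof (intro allI impI ballI)
  fix z :: complex and v :: "complex vec"
  let ?U = "1\<^sub>m n + (z - 1) \<cdot>\<^sub>m mat_unit n i i"
  assume z: "cmod z = 1" and "v \<in> carrier_vec (dim_col ?U)"
  hence v: "v \<in> carrier_vec n" by (simp add: mat_unit_def)
  have "(?U *\<^sub>v v) $ x = (if x = i then z else 1) * v $ x" if x: "x < n" for x
    using v x i
    by (auto simp: one_plus_smult_mult_vec mat_unit_mult_vec algebra_simps simp del: index_mult_mat_vec)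
  thus "lp_sum p (?U *\<^sub>v v) \<le> lp_sum p v"
    using v z p by (intro lp_sum_mono) (auto simp: norm_mult simp: mat_unit_def simp del: index_mult_mat_vec)
qed

text \<open>
  Split \<open>\<ell>\<^sup>p\<close> along the coordinate projection onto \<open>S\<close>. On the coordinates outside \<open>S\<close> the matrix
  \<open>1 + (z - 1) f\<close> is the identity, and on those in \<open>S\<close> it is the given contraction. Norms are
  \<open>p\<close>-additive along the splitting.
\<close>

lemma lp_hermitian_corner:
  assumes p: "0 < p" and f: "f \<in> carrier_mat n n"
    and ef: "coord_proj n S * f = f" and fe: "f * coord_proj n S = f"
    and contr: "\<And>z. cmod z = 1 \<Longrightarrow> lp_contraction p (coord_proj n S + (z - 1) \<cdot>\<^sub>m f)"
  shows "lp_hermitian p n f"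
  unfolding lp_hermitian_def lp_contraction_iff[OF p]
proof (intro allI impI ballI)
  fix z :: complex and v :: "complex vec"
  let ?E = "coord_proj n S"
  define G where "G = ?E + (z - 1) \<cdot>\<^sub>m f"
  assume z: "cmod z = 1" and "v \<in> carrier_vec (dim_col (1\<^sub>m n + (z - 1) \<cdot>\<^sub>m f))"
  hence v: "v \<in> carrier_vec n" using f by simp
  have E: "?E \<in> carrier_mat n n" by (simp add: coord_proj_def)
  have G: "G \<in> carrier_mat n n" using E f by (simp add: G_def)
  have EE: "?E * ?E = ?E"
    using coord_proj_mult_nth[OF E] by (intro eq_matI) (auto simp: coord_proj_def simp del: index_mult_mat(1))
  have GE: "G * ?E = G"
    using E f fe EE by (simp add: G_def add_mult_distrib_mat[of _ n n _ _ n] mult_smult_assoc_mat[of _ n n _ n])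
  have Gv: "(G *\<^sub>v v) $ y = (?E *\<^sub>v v) $ y + (z - 1) * (f *\<^sub>v v) $ y" if "y < n" for y
  proof -
    have "G *\<^sub>v v = ?E *\<^sub>v v + ((z - 1) \<cdot>\<^sub>m f) *\<^sub>v v"
      unfolding G_def using E f v by (intro add_mult_distrib_mat_vec) auto
    thus ?thesis using that E f v by simp
  qed
  note Uv = one_plus_smult_mult_vec[OF f v]
  have fv: "(f *\<^sub>v v) $ y = 0" if "y < n" "y \<notin> S" for y
  proof -
    have "f *\<^sub>v v = ?E *\<^sub>v (f *\<^sub>v v)" using E f v ef by (metis assoc_mult_mat_vec)
    moreover have "f *\<^sub>v v \<in> carrier_vec n" using f v by simp
    ultimately show ?thesis using that coord_proj_mult_vec[of "f *\<^sub>v v" n y S] by simp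
  qed
  have "lp_sum p ((1\<^sub>m n + (z - 1) \<cdot>\<^sub>m f) *\<^sub>v v)
      = (\<Sum>y<n. if y \<in> S then cmod ((G *\<^sub>v v) $ y) powr p else cmod (v $ y) powr p)"
    unfolding lp_sum_def using f v E
    by (intro sum.cong) (auto simp: Uv Gv fv coord_proj_mult_vec simp del: index_mult_mat_vec)
  also have "\<dots> \<le> (\<Sum>y<n. cmod ((G *\<^sub>v v) $ y) powr p + (if y \<in> S then 0 else cmod (v $ y) powr p))"
    by (intro sum_mono) auto
  also have "\<dots> = lp_sum p (G *\<^sub>v v) + (\<Sum>y<n. if y \<in> S then 0 else cmod (v $ y) powr p)"
    using G by (simp add: sum.distrib lp_sum_def del: index_mult_mat_vec)
  also have "lp_sum p (G *\<^sub>v v) \<le> lp_sum p (?E *\<^sub>v v)"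
  proof -
    have "G *\<^sub>v v = G *\<^sub>v (?E *\<^sub>v v)" using E G v GE by (metis assoc_mult_mat_vec)
    moreover have "?E *\<^sub>v v \<in> carrier_vec (dim_col G)" using carrier_matD[OF E] carrier_matD[OF G] by (intro carrier_vecI) simp
    ultimately show ?thesis
      using contr[OF z] unfolding lp_contraction_iff[OF p] G_def[symmetric] by metis
  qed
  also have "lp_sum p (?E *\<^sub>v v) = (\<Sum>y<n. if y \<in> S then cmod (v $ y) powr p else 0)"
    unfolding lp_sum_def using v E
    by (intro sum.cong) (auto simp: coord_proj_mult_vec simp del: index_mult_mat_vec)
  finally have "lp_sum p ((1\<^sub>m n + (z - 1) \<cdot>\<^sub>m f) *\<^sub>v v) \<le>
      (\<Sum>y<n. if y \<in> S then cmod (v $ y) powr p else 0) + (\<Sum>y<n. if y \<in> S then 0 else cmod (v $ y) powr p)"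
    by simp
  also have "\<dots> = lp_sum p v"
    using v by (auto simp: lp_sum_def simp flip: sum.distrib intro!: sum.cong)
  finally show "lp_sum p ((1\<^sub>m n + (z - 1) \<cdot>\<^sub>m f) *\<^sub>v v) \<le> lp_sum p v" .
qed

context dsum_mat_hom
begin

text \<open>
  The matrix \<open>1 + (z - 1) e\<^sub>i\<^sub>i\<close> is diagonal with unimodular entries, hence a contraction, and therefore so
  is its image \<open>E + (z - 1) f\<close>, where \<open>E\<close> and \<open>f\<close> are the images of the identity of the summand and of
  \<open>e\<^sub>i\<^sub>i\<close>. As \<open>E\<close> is a coordinate projection, \<open>lp_hermitian_corner\<close> makes \<open>f\<close> hermitian.
\<close>

lemma hom_mat_unit_coord_proj:
  assumes p: "0 < p" "p \<noteq> 2" and j: "j < length c" and i: "i < c ! j"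
    and contr: "\<And>x. x \<in> carrier_mat (c ! j) (c ! j) \<Longrightarrow>
      lp_op_norm p (\<rho> (dsum_incl c j x)) \<le> lp_op_norm p x"
    and herm: "lp_hermitian p n (\<rho> (dsum_incl c j (1\<^sub>m (c ! j))))"
  shows "unit_image j i i = coord_proj n {y. y < n \<and> unit_image j i i $$ (y, y) = 1}"
proof -
  define E where "E = \<rho> (dsum_incl c j (1\<^sub>m (c ! j)))"
  have incl_mult: "dsum_mult (dsum_incl c j x) (dsum_incl c j y) = dsum_incl c j (x * y)"
    if "x \<in> carrier_mat (c ! j) (c ! j)" "y \<in> carrier_mat (c ! j) (c ! j)" for x y
    using that j by (intro nth_equalityI) (auto simp: dsum_incl_def nth_list_update)
  have E: "E \<in> carrier_mat n n" "E * E = E"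
    by (simp_all add: E_def incl_mult flip: hom_mult)
  have u: "mat_unit (c ! j) i i * mat_unit (c ! j) i i = mat_unit (c ! j) i i"
    using mat_unit_corner[of "1\<^sub>m (c ! j)" "c ! j" i i i i] i
    by (auto intro!: eq_matI simp: mat_unit_def)
  define S where "S = {y. y < n \<and> E $$ (y, y) = 1}"
  have ES: "E = coord_proj n S"
    unfolding S_def by (rule hermitian_idempotent_coord_proj[OF p E herm[folded E_def]])
  have "lp_hermitian p n (unit_image j i i)"
  proof (rule lp_hermitian_corner[OF p(1) unit_image_carrier])
    show "coord_proj n S * unit_image j i i = unit_image j i i"
      "unit_image j i i * coord_proj n S = unit_image j i i"
      unfolding ES[symmetric] by (simp_all add: E_def unit_image_def incl_mult flip: hom_mult)
    fix z :: complex assume z: "cmod z = 1"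
    define U where "U = 1\<^sub>m (c ! j) + (z - 1) \<cdot>\<^sub>m mat_unit (c ! j) i i"
    have U: "U \<in> carrier_mat (c ! j) (c ! j)" by (simp add: U_def)
    have "dsum_incl c j U = dsum_add (dsum_incl c j (1\<^sub>m (c ! j)))
        (dsum_smult (z - 1) (dsum_incl c j (mat_unit (c ! j) i i)))"
      using j by (intro nth_equalityI) (auto simp: dsum_incl_def nth_list_update U_def)
    hence "\<rho> (dsum_incl c j U) = coord_proj n S + (z - 1) \<cdot>\<^sub>m unit_image j i i"
      by (simp add: hom_add hom_smult unit_image_def E_def flip: ES)
    moreover have "lp_op_norm p U \<le> 1"
      using lp_hermitian_mat_unit[OF p(1) i] z p
      by (simp add: lp_op_norm_le_iff U_def lp_hermitian_def)
    hence "lp_op_norm p (\<rho> (dsum_incl c j U)) \<le> 1" using contr[OF U] by simp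
    ultimately show "lp_contraction p (coord_proj n S + (z - 1) \<cdot>\<^sub>m unit_image j i i)"
      using p by (simp add: lp_op_norm_le_iff)
  qed
  moreover have "unit_image j i i * unit_image j i i = unit_image j i i"
    by (simp add: unit_image_def incl_mult u flip: hom_mult)
  ultimately show ?thesis
    by (intro hermitian_idempotent_coord_proj[OF p unit_image_carrier])
qed

end

section \<open>Unitization\<close>

lemma dsum_snoc_cases:
  assumes "b \<in> dsum (c @ [1])"
  obtains a m where "b = a @ [m]" "a \<in> dsum c" "m \<in> carrier_mat 1 1"
proof
  have len: "length b = Suc (length c)" using dsum_length[OF assms] by simp
  hence "b \<noteq> []" by auto
  thus "b = butlast b @ [last b]" by simp
  show "butlast b \<in> dsum c"
  proof -
    have "b ! j \<in> carrier_mat (c ! j) (c ! j)" if "j < length c" for j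
      using dsum_nth[OF assms, of j] that by (simp add: nth_append)
    thus ?thesis using len by (auto simp: dsum_def nth_butlast)
  qed
  show "last b \<in> carrier_mat 1 1"
    using len dsum_nth[OF assms, of "length c"] \<open>b \<noteq> []\<close> by (simp add: last_conv_nth)
qed

context dsum_mat_hom
begin

text \<open>
  The value of the unitization at the identity of the added summand.
\<close>

definition compl_idem :: "complex mat" where
  "compl_idem = 1\<^sub>m n - \<rho> (dsum_one c)"

lemma compl_idem_carrier [simp]: "compl_idem \<in> carrier_mat n n"
  unfolding compl_idem_def by (rule minus_carrier_mat) simp

lemma hom_mult_compl_idem:
  assumes "a \<in> dsum c"
  shows "\<rho> a * compl_idem = 0\<^sub>m n n" "compl_idem * \<rho> a = 0\<^sub>m n n"
proof -
  have carr: "\<rho> a \<in> carrier_mat n n" "\<rho> (dsum_one c) \<in> carrier_mat n n" using assms by auto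
  have "\<rho> a * compl_idem = \<rho> a * 1\<^sub>m n - \<rho> a * \<rho> (dsum_one c)"
    unfolding compl_idem_def using carr by (intro mult_minus_distrib_mat) auto
  also have "\<dots> = \<rho> a - \<rho> a" using assms carrier_matD[OF carr(1)] by (simp flip: hom_mult)
  also have "\<dots> = 0\<^sub>m n n" using carr by (intro eq_matI) auto
  finally show "\<rho> a * compl_idem = 0\<^sub>m n n" .
  have "compl_idem * \<rho> a = 1\<^sub>m n * \<rho> a - \<rho> (dsum_one c) * \<rho> a"
    unfolding compl_idem_def using carr by (intro minus_mult_distrib_mat) auto
  also have "\<dots> = \<rho> a - \<rho> a" using assms carrier_matD[OF carr(1)] by (simp flip: hom_mult)
  also have "\<dots> = 0\<^sub>m n n" using carr by (intro eq_matI) auto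
  finally show "compl_idem * \<rho> a = 0\<^sub>m n n" .
qed

lemma compl_idem_idem: "compl_idem * compl_idem = compl_idem"
proof -
  have "compl_idem * compl_idem = 1\<^sub>m n * compl_idem - \<rho> (dsum_one c) * compl_idem"
    by (subst (1) compl_idem_def, rule minus_mult_distrib_mat[of _ n n _ _ n]) auto
  also have "\<dots> = compl_idem - 0\<^sub>m n n"
    using carrier_matD[OF compl_idem_carrier] by (simp add: hom_mult_compl_idem)
  also have "\<dots> = compl_idem"
    using carrier_matD[OF compl_idem_carrier] by (intro eq_matI) auto
  finally show ?thesis .
qed

lemma unitization_snoc:
  "unitization c n \<rho> (a @ [m]) = \<rho> a + m $$ (0, 0) \<cdot>\<^sub>m compl_idem"
  by (simp add: unitization_def compl_idem_def)

lemma dsum_mat_hom_unitization: "dsum_mat_hom (c @ [1]) n (unitization c n \<rho>)"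
proof
  show "0 < (c @ [1]) ! j" if "j < length (c @ [1])" for j
    using that size_pos[of j] by (auto simp: nth_append less_Suc_eq)
  show "unitization c n \<rho> b \<in> carrier_mat n n" if b: "b \<in> dsum (c @ [1])" for b
    using b by (cases rule: dsum_snoc_cases) (simp add: unitization_snoc)
next
  fix b b' assume b: "b \<in> dsum (c @ [1])" "b' \<in> dsum (c @ [1])"
  obtain a m where am: "b = a @ [m]" "a \<in> dsum c" "m \<in> carrier_mat 1 1"
    using b(1) by (rule dsum_snoc_cases)
  obtain a' m' where am': "b' = a' @ [m']" "a' \<in> dsum c" "m' \<in> carrier_mat 1 1"
    using b(2) by (rule dsum_snoc_cases)
  have len: "length a = length a'" using am am' by (simp add: dsum_length)
  note carr = hom_carrier[OF am(2)] hom_carrier[OF am'(2)] compl_idem_carrier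
  note dims = carr[THEN carrier_matD(1)] carr[THEN carrier_matD(2)]
  have "unitization c n \<rho> (dsum_add b b') = (\<rho> a + \<rho> a') + (m + m') $$ (0, 0) \<cdot>\<^sub>m compl_idem"
    using am am' len by (simp only: zip_append list.map map_append zip.simps)
      (simp add: unitization_snoc hom_add)
  also have "\<dots> = unitization c n \<rho> b + unitization c n \<rho> b'"
    using am(3) am'(3) by (intro eq_matI) (auto simp: am(1) am'(1) unitization_snoc dims algebra_simps)
  finally show "unitization c n \<rho> (dsum_add b b') = unitization c n \<rho> b + unitization c n \<rho> b'" .
  have mm: "(m * m') $$ (0, 0) = m $$ (0, 0) * m' $$ (0, 0)"
    using am(3) am'(3) by (simp add: scalar_prod_def)
  have "unitization c n \<rho> (dsum_mult b b') =
      \<rho> a * \<rho> a' + (m $$ (0, 0) * m' $$ (0, 0)) \<cdot>\<^sub>m compl_idem"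
    using am am' len by (simp only: zip_append list.map map_append zip.simps)
      (simp add: unitization_snoc hom_mult mm del: index_mult_mat)
  also have "\<dots> = (\<rho> a + m $$ (0, 0) \<cdot>\<^sub>m compl_idem) * (\<rho> a' + m' $$ (0, 0) \<cdot>\<^sub>m compl_idem)"
  proof -
    let ?mu = "m $$ (0, 0)" and ?mu' = "m' $$ (0, 0)"
    have z: "k \<cdot>\<^sub>m 0\<^sub>m n n = (0\<^sub>m n n :: complex mat)" for k by (intro eq_matI) auto
    have 1: "\<rho> a * (\<rho> a' + ?mu' \<cdot>\<^sub>m compl_idem) = \<rho> a * \<rho> a'"
      using carr am by (subst mult_add_distrib_mat[of _ n n _ n])
        (auto simp: mult_smult_distrib[of _ n n _ n] hom_mult_compl_idem z
          intro!: right_add_zero_mat[of _ n n] mult_carrier_mat[of _ n n] hom_carrier)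
    have 2: "(?mu \<cdot>\<^sub>m compl_idem) * (\<rho> a' + ?mu' \<cdot>\<^sub>m compl_idem) = (?mu * ?mu') \<cdot>\<^sub>m compl_idem"
      using carr am' by (subst mult_add_distrib_mat[of _ n n _ n])
        (auto simp: mult_smult_distrib[of _ n n _ n] mult_smult_assoc_mat[of _ n n _ n]
          hom_mult_compl_idem compl_idem_idem z smult_smult_mat mult.commute
          intro!: left_add_zero_mat[of _ n n])
    show ?thesis
      using carr by (subst add_mult_distrib_mat[of _ n n _ _ n]) (simp_all only: 1 2, auto)
  qed
  also have "\<dots> = unitization c n \<rho> b * unitization c n \<rho> b'"
    by (simp add: am am' unitization_snoc)
  finally show "unitization c n \<rho> (dsum_mult b b') = unitization c n \<rho> b * unitization c n \<rho> b'" .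
next
  fix b z assume b: "b \<in> dsum (c @ [1])"
  then obtain a m where am: "b = a @ [m]" "a \<in> dsum c" "m \<in> carrier_mat 1 1"
    by (rule dsum_snoc_cases)
  thus "unitization c n \<rho> (dsum_smult z b) = z \<cdot>\<^sub>m unitization c n \<rho> b"
    using carrier_matD[OF hom_carrier[OF am(2)]] carrier_matD[OF compl_idem_carrier]
    by (auto simp: unitization_snoc hom_smult algebra_simps intro!: eq_matI)
qed

lemma conj_unitization:
  assumes s: "s \<in> carrier_mat n n" "s' \<in> carrier_mat n n" "s * s' = 1\<^sub>m n"
    and b: "b \<in> dsum (c @ [1])"
  shows "unitization c n (\<lambda>a. s * \<rho> a * s') b = s * unitization c n \<rho> b * s'"
proof -
  obtain a m where am: "b = a @ [m]" "a \<in> dsum c" "m \<in> carrier_mat 1 1"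
    using b by (rule dsum_snoc_cases)
  note carr = hom_carrier[OF am(2)] hom_carrier[OF dsum_one_carrier] compl_idem_carrier
  let ?\<mu> = "m $$ (0, 0)"
  have "s * compl_idem * s' = (s * 1\<^sub>m n - s * \<rho> (dsum_one c)) * s'"
    unfolding compl_idem_def using s carr by (subst mult_minus_distrib_mat[of _ n n _ n]) auto
  also have "\<dots> = s * s' - s * \<rho> (dsum_one c) * s'"
    using s carr by (subst minus_mult_distrib_mat[of _ n n _ _ n]) auto
  finally have Q: "s * compl_idem * s' = 1\<^sub>m n - s * \<rho> (dsum_one c) * s'" using s by simp
  have "s * (\<rho> a + ?\<mu> \<cdot>\<^sub>m compl_idem) * s' = (s * \<rho> a + ?\<mu> \<cdot>\<^sub>m (s * compl_idem)) * s'"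
    using s carr by (subst mult_add_distrib_mat[of _ n n _ n]) (auto simp: mult_smult_distrib[of _ n n _ n])
  also have "\<dots> = s * \<rho> a * s' + ?\<mu> \<cdot>\<^sub>m (s * compl_idem * s')"
    using s carr by (subst add_mult_distrib_mat[of _ n n _ _ n]) (auto simp: mult_smult_assoc_mat[of _ n n _ n])
  finally show ?thesis by (simp only: am(1) unitization_snoc Q) (simp add: unitization_def)
qed

end

section \<open>Block diagonalization of one component\<close>

text \<open>
  In the nonunital case the unitization is a unital homomorphism on the direct sum with one more summand
  of size \<open>1\<close>, whose only matrix unit has the image \<open>1 - \<rho>(1)\<close>. This is again a coordinate projection,
  because \<open>\<rho>(1)\<close> is a sum of mutually orthogonal ones. Unitization commutes with conjugation by \<open>s\<close>
  (\<open>conj_unitization\<close>), so that diagonalizing the unitization of \<open>\<rho>\<close> gives what is required of the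
  conjugate of \<open>\<rho>\<close>.
\<close>

lemma mat_hom_block_diagonalization:
  assumes p: "0 < p" "p \<noteq> 2" and n: "0 < n" and hom: "dsum_mat_hom c n \<rho>"
    and contr: "\<And>j x. j < length c \<Longrightarrow> x \<in> carrier_mat (c ! j) (c ! j) \<Longrightarrow>
      lp_op_norm p (\<rho> (dsum_incl c j x)) \<le> lp_op_norm p x"
    and herm: "\<And>j. j < length c \<Longrightarrow> lp_hermitian p n (\<rho> (dsum_incl c j (1\<^sub>m (c ! j))))"
  shows "\<exists>s s'. s \<in> carrier_mat n n \<and> s' \<in> carrier_mat n n \<and> s * s' = 1\<^sub>m n \<and> s' * s = 1\<^sub>m n \<and>
    lp_contraction p s \<and> lp_contraction p s' \<and> mat_block_diagonal c n (\<lambda>a. s * \<rho> a * s')"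
proof -
  interpret dsum_mat_hom c n \<rho> by (rule hom)
  define S where "S j i = {y. y < n \<and> unit_image j i i $$ (y, y) = 1}" for j i
  have diag: "unit_image j i i = coord_proj n (S j i)" if "j < length c" "i < c ! j" for j i
    unfolding S_def using that by (intro hom_mat_unit_coord_proj[OF p] contr herm)
  have F_contr: "lp_contraction p (unit_image j k i)"
    if "j < length c" "k < c ! j" "i < c ! j" for j k i
  proof -
    have "lp_op_norm p (mat_unit (c ! j) k i) \<le> 1"
      using lp_contraction_mat_unit[OF p(1) that(3)] p by (simp add: lp_op_norm_le_iff)
    hence "lp_op_norm p (unit_image j k i) \<le> 1"
      using contr[OF that(1) mat_unit_carrier, of k i] by (simp add: unit_image_def)
    thus ?thesis using p by (simp add: lp_op_norm_le_iff)
  qed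
  show ?thesis
  proof (cases "\<rho> (dsum_one c) = 1\<^sub>m n")
    case True
    interpret contractive_unital_hom c n \<rho> p S
      by unfold_locales (use p True F_contr diag in \<open>auto simp: S_def\<close>)
    obtain r s s' where r: "set r \<subseteq> {..<length c}" "(\<Sum>k\<leftarrow>r. c ! k) = n"
      and s: "s \<in> carrier_mat n n" "s' \<in> carrier_mat n n" "s * s' = 1\<^sub>m n" "s' * s = 1\<^sub>m n"
        "lp_contraction p s" "lp_contraction p s'"
      and eq: "\<forall>a\<in>dsum c. s * \<rho> a * s' = diag_block_mat (map (\<lambda>k. a ! k) r)"
      by (rule isometry_to_block_diagonal)
    have "r \<noteq> []" using r(2) n by auto
    hence "unital_block_diagonal c n (\<lambda>a. s * \<rho> a * s')"
      using r eq unfolding unital_block_diagonal_def by blast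
    moreover have "s * \<rho> (dsum_one c) * s' = 1\<^sub>m n" using s by (simp add: True)
    ultimately show ?thesis using s unfolding mat_block_diagonal_def by auto
  next
    case False
    let ?u = "unitization c n \<rho>"
    interpret U: dsum_mat_hom "c @ [1]" n ?u by (rule dsum_mat_hom_unitization)
    have incl_old: "dsum_incl (c @ [1]) j x = dsum_incl c j x @ [0\<^sub>m 1 1]" if "j < length c" for j x
      using that by (simp add: dsum_incl_def list_update_append)
    have incl_new: "dsum_incl (c @ [1]) (length c) x = dsum_smult 0 (dsum_one c) @ [x]" for x
      by (simp add: dsum_incl_def list_update_append dsum_one_def) (auto intro!: eq_matI)
    have img_old: "U.unit_image j k i = unit_image j k i" if "j < length c" for j k i
    proof -
      have "U.unit_image j k i = unit_image j k i + 0\<^sub>m 1 1 $$ (0, 0) \<cdot>\<^sub>m compl_idem"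
        using that by (simp only: U.unit_image_def unit_image_def incl_old unitization_snoc nth_append if_True)
      also have "\<dots> = unit_image j k i"
        using carrier_matD[OF unit_image_carrier] carrier_matD[OF compl_idem_carrier]
        by (intro eq_matI) auto
      finally show ?thesis .
    qed
    have img_new: "U.unit_image (length c) 0 0 = compl_idem"
    proof -
      have "U.unit_image (length c) 0 0 =
          \<rho> (dsum_smult 0 (dsum_one c)) + mat_unit 1 0 0 $$ (0, 0) \<cdot>\<^sub>m compl_idem"
        by (simp only: U.unit_image_def incl_new unitization_snoc nth_append_length)
      also have "\<dots> = compl_idem"
        using carrier_matD[OF hom_carrier[OF dsum_one_carrier]] carrier_matD[OF compl_idem_carrier]
        by (intro eq_matI) (auto simp: hom_smult mat_unit_def)
      finally show ?thesis .
    qed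
    define S' where "S' j i = {y. y < n \<and> U.unit_image j i i $$ (y, y) = 1}" for j i
    have compl: "compl_idem = coord_proj n {y. y < n \<and> compl_idem $$ (y, y) = 1}"
    proof -
      have off: "compl_idem $$ (x, y) = 0" if "x < n" "y < n" "x \<noteq> y" for x y
      proof -
        have "\<rho> (dsum_one c) $$ (x, y) = (\<Sum>(j, i)\<in>diag_positions. unit_image j i i $$ (x, y))"
          using sum_unit_image that by simp
        also have "\<dots> = 0"
          using that by (intro sum.neutral) (auto simp: diag_positions_def diag coord_proj_def)
        finally show ?thesis
          using that carrier_matD[OF hom_carrier[OF dsum_one_carrier]] by (simp add: compl_idem_def)
      qed
      have on: "compl_idem $$ (y, y) = 0 \<or> compl_idem $$ (y, y) = 1" if "y < n" for y
      proof -
        have "compl_idem $$ (y, y) = (compl_idem * compl_idem) $$ (y, y)"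
          by (simp add: compl_idem_idem)
        also have "\<dots> = (\<Sum>l<n. compl_idem $$ (y, l) * compl_idem $$ (l, y))"
          using that carrier_matD[OF compl_idem_carrier] by (simp add: scalar_prod_def atLeast0LessThan)
        also have "\<dots> = (\<Sum>l<n. if l = y then compl_idem $$ (y, y) * compl_idem $$ (y, y) else 0)"
          using off that by (intro sum.cong) auto
        also have "\<dots> = compl_idem $$ (y, y) * compl_idem $$ (y, y)"
          using that by simp
        finally show ?thesis by simp
      qed
      show ?thesis
        using carrier_matD[OF compl_idem_carrier] off on
        by (intro eq_matI) (auto simp: coord_proj_def)
    qed
    have one_nth: "(c @ [1]) ! length c = 1" by simp
    interpret U: contractive_unital_hom "c @ [1]" n ?u p S'
    proof
      show "0 < p" by (rule p)
      have "dsum_one (c @ [1]) = dsum_one c @ [1\<^sub>m 1]" by (simp add: dsum_one_def)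
      thus "?u (dsum_one (c @ [1])) = 1\<^sub>m n"
        using carrier_matD[OF hom_carrier[OF dsum_one_carrier]]
        by (simp add: unitization_snoc compl_idem_def) (intro eq_matI, auto)
      show "lp_contraction p (U.unit_image j k i)"
        if "j < length (c @ [1])" "k < (c @ [1]) ! j" "i < (c @ [1]) ! j" for j k i
      proof (cases "j < length c")
        case True
        thus ?thesis unfolding img_old[OF True] using that by (intro F_contr) (simp_all add: nth_append)
      next
        case False
        hence "j = length c" using that by simp
        thus ?thesis using that img_new lp_contraction_coord_proj[OF p(1)] compl by (metis less_one one_nth)
      qed
      show "U.unit_image j i i = coord_proj n (S' j i)"
        if "j < length (c @ [1])" "i < (c @ [1]) ! j" for j i
      proof (cases "j < length c")
        case True
        thus ?thesis using that diag[of j i] unfolding S'_def img_old[OF True]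
          by (simp add: nth_append S_def)
      next
        case False
        hence "j = length c" using that by simp
        hence ji: "j = length c" "i = 0" using that(2) one_nth by (simp_all only: less_one)
        show ?thesis unfolding ji S'_def img_new by (rule compl)
      qed
      show "S' j i \<subseteq> {..<n}" for j i by (auto simp: S'_def)
    qed
    obtain r s s' where r: "set r \<subseteq> {..<length (c @ [1])}" "(\<Sum>k\<leftarrow>r. (c @ [1]) ! k) = n"
      and s: "s \<in> carrier_mat n n" "s' \<in> carrier_mat n n" "s * s' = 1\<^sub>m n" "s' * s = 1\<^sub>m n"
        "lp_contraction p s" "lp_contraction p s'"
      and eq: "\<forall>a\<in>dsum (c @ [1]). s * ?u a * s' = diag_block_mat (map (\<lambda>k. a ! k) r)"
      by (rule U.isometry_to_block_diagonal)
    have "r \<noteq> []" using r(2) n by auto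
    hence "unital_block_diagonal (c @ [1]) n (unitization c n (\<lambda>a. s * \<rho> a * s'))"
      using r eq conj_unitization[OF s(1-3)] unfolding unital_block_diagonal_def by metis
    moreover have "s * \<rho> (dsum_one c) * s' \<noteq> 1\<^sub>m n"
    proof
      assume 1: "s * \<rho> (dsum_one c) * s' = 1\<^sub>m n"
      have carr: "\<rho> (dsum_one c) \<in> carrier_mat n n" by simp
      have "s' * (s * \<rho> (dsum_one c) * s') * s = (s' * s) * \<rho> (dsum_one c) * (s' * s)"
        using s(1,2) carr by (simp add: assoc_mult_mat[of _ n n _ n _ n] mult_carrier_mat[of _ n n])
      hence "\<rho> (dsum_one c) = 1\<^sub>m n" using 1 s carrier_matD[OF carr] by simp
      thus False using False by simp
    qed
    ultimately show ?thesis using s unfolding mat_block_diagonal_def by auto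
  qed
qed

section \<open>Block diagonal homomorphisms\<close>

text \<open>
  A common form for the unital and the nonunital case: the blocks of \<open>\<psi>(a)\<close> are components of \<open>a\<close>
  or zero blocks of size \<open>1\<close>, since the unitization agrees with \<open>\<psi>\<close> where the added component is \<open>0\<close>.
\<close>

lemma mat_block_diagonal_blocks:
  assumes carr: "\<And>a. a \<in> dsum c \<Longrightarrow> \<psi> a \<in> carrier_mat n n" and bd: "mat_block_diagonal c n \<psi>"
  obtains r where "set r \<subseteq> {..<length (c @ [1])}" "(\<Sum>k\<leftarrow>r. (c @ [1]) ! k) = n"
    "\<forall>a\<in>dsum c. \<psi> a = diag_block_mat (map (\<lambda>k. (a @ [0\<^sub>m 1 1]) ! k) r)"
proof (cases "\<psi> (dsum_one c) = 1\<^sub>m n")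
  case True
  then obtain r where r: "set r \<subseteq> {..<length c}" "(\<Sum>k\<leftarrow>r. c ! k) = n"
    "\<forall>a\<in>dsum c. \<psi> a = diag_block_mat (map (\<lambda>k. a ! k) r)"
    using bd by (auto simp: mat_block_diagonal_def unital_block_diagonal_def)
  show thesis
  proof (rule that[of r])
    show "set r \<subseteq> {..<length (c @ [1])}" using r(1) by auto
    have "map (\<lambda>k. (c @ [1]) ! k) r = map (\<lambda>k. c ! k) r"
      using r(1) by (auto simp: nth_append)
    thus "(\<Sum>k\<leftarrow>r. (c @ [1]) ! k) = n" using r(2) by (simp only:)
    show "\<forall>a\<in>dsum c. \<psi> a = diag_block_mat (map (\<lambda>k. (a @ [0\<^sub>m 1 1]) ! k) r)"
    proof
      fix a assume a: "a \<in> dsum c"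
      have "map (\<lambda>k. (a @ [0\<^sub>m 1 1]) ! k) r = map (\<lambda>k. a ! k) r"
        using r(1) dsum_length[OF a] by (auto simp: nth_append)
      thus "\<psi> a = diag_block_mat (map (\<lambda>k. (a @ [0\<^sub>m 1 1]) ! k) r)"
        using r(3) a by (simp only:)
    qed
  qed
next
  case False
  then obtain r where r: "set r \<subseteq> {..<length (c @ [1])}" "(\<Sum>k\<leftarrow>r. (c @ [1]) ! k) = n"
    "\<forall>a\<in>dsum (c @ [1]). unitization c n \<psi> a = diag_block_mat (map (\<lambda>k. a ! k) r)"
    using bd unfolding mat_block_diagonal_def unital_block_diagonal_def by metis
  show thesis
  proof (rule that[OF r(1,2)], rule)
    fix a assume a: "a \<in> dsum c"
    have "a @ [0\<^sub>m 1 1] \<in> dsum (c @ [1])" using a by (auto simp: dsum_def nth_append less_Suc_eq)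
    hence "unitization c n \<psi> (a @ [0\<^sub>m 1 1]) = diag_block_mat (map (\<lambda>k. (a @ [0\<^sub>m 1 1]) ! k) r)"
      using r(3) by blast
    moreover have "unitization c n \<psi> (a @ [0\<^sub>m 1 1]) = \<psi> a"
      using carrier_matD[OF carr[OF a]] carrier_matD[OF carr[OF dsum_one_carrier]]
      by (intro eq_matI) (auto simp: unitization_def)
    ultimately show "\<psi> a = diag_block_mat (map (\<lambda>k. (a @ [0\<^sub>m 1 1]) ! k) r)" by simp
  qed
qed

lemma lp_bounded_zero: "0 < p \<Longrightarrow> 0 \<le> K \<Longrightarrow> lp_bounded p K (0\<^sub>m n m)"
  unfolding lp_bounded_iff_lp_sum
proof
  fix v :: "complex vec" assume "0 < p" "0 \<le> K" "v \<in> carrier_vec (dim_col (0\<^sub>m n m :: complex mat))"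
  hence "0\<^sub>m n m *\<^sub>v v = 0\<^sub>v n" by (intro eq_vecI) auto
  thus "lp_sum p (0\<^sub>m n m *\<^sub>v v) \<le> K powr p * lp_sum p v" by (simp add: lp_sum_nonneg)
qed

lemma lp_contraction_scalar:
  assumes p: "0 < p" and z: "cmod z = 1"
  shows "lp_contraction p (z \<cdot>\<^sub>m 1\<^sub>m n)"
  unfolding lp_contraction_iff[OF p]
proof
  fix v :: "complex vec" assume "v \<in> carrier_vec (dim_col (z \<cdot>\<^sub>m 1\<^sub>m n))"
  hence "(z \<cdot>\<^sub>m 1\<^sub>m n) *\<^sub>v v = z \<cdot>\<^sub>v v" by (intro eq_vecI) auto
  thus "lp_sum p ((z \<cdot>\<^sub>m 1\<^sub>m n) *\<^sub>v v) \<le> lp_sum p v" by (simp add: lp_sum_smult z)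
qed

lemma dsum_incl_snoc_nth:
  assumes "j < length c" "k < length (c @ [1])"
  shows "(dsum_incl c j x @ [0\<^sub>m 1 1]) ! k = (if k = j then x else 0\<^sub>m ((c @ [1]) ! k) ((c @ [1]) ! k))"
  using assms by (auto simp: nth_append dsum_incl_nth) (auto simp: dsum_incl_def less_Suc_eq)

lemma lp_hermitian_diag_block_mat:
  assumes p: "0 < p" and As: "\<And>A. A \<in> set As \<Longrightarrow> \<exists>m. A = 1\<^sub>m m \<or> A = 0\<^sub>m m m"
    and n: "sum_list (map dim_row As) = n"
  shows "lp_hermitian p n (diag_block_mat As)"
  unfolding lp_hermitian_def
proof (intro allI impI)
  fix z :: complex assume z: "cmod z = 1"
  have sq: "\<forall>A\<in>set As. square_mat A" using As by fastforce
  have "lp_contraction p (diag_block_mat (map (\<lambda>A. 1\<^sub>m (dim_row A) + (z - 1) \<cdot>\<^sub>m A) As))"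
  proof (rule lp_bounded_diag_block_mat[OF p zero_le_one], unfold set_map ball_simps, intro ballI)
    fix A assume A: "A \<in> set As"
    then obtain m where m: "A = 1\<^sub>m m \<or> A = 0\<^sub>m m m" using As by blast
    have "1\<^sub>m m + (z - 1) \<cdot>\<^sub>m 1\<^sub>m m = z \<cdot>\<^sub>m 1\<^sub>m m" by (intro eq_matI) auto
    moreover have "1\<^sub>m m + (z - 1) \<cdot>\<^sub>m 0\<^sub>m m m = 1 \<cdot>\<^sub>m 1\<^sub>m m" by (intro eq_matI) auto
    ultimately show "square_mat (1\<^sub>m (dim_row A) + (z - 1) \<cdot>\<^sub>m A) \<and> lp_contraction p (1\<^sub>m (dim_row A) + (z - 1) \<cdot>\<^sub>m A)"
      using m lp_contraction_scalar[OF p z, of m] lp_contraction_scalar[OF p, of 1 m] by auto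
  qed
  thus "lp_contraction p (1\<^sub>m n + (z - 1) \<cdot>\<^sub>m diag_block_mat As)"
    by (simp add: one_plus_smult_diag_block_mat[OF sq, unfolded n])
qed

text \<open>
  At an element supported in the \<open>j\<close>-th summand all blocks are \<open>x\<close> or zero.
\<close>

lemma block_diagonal_incl_bound:
  assumes p: "0 < p" and carr: "\<And>a. a \<in> dsum c \<Longrightarrow> \<psi> a \<in> carrier_mat n n"
    and bd: "mat_block_diagonal c n \<psi>" and j: "j < length c"
  shows "x \<in> carrier_mat (c ! j) (c ! j) \<Longrightarrow> lp_bounded p (lp_op_norm p x) (\<psi> (dsum_incl c j x))"
    and "lp_hermitian p n (\<psi> (dsum_incl c j (1\<^sub>m (c ! j))))"
proof -
  obtain r where r: "set r \<subseteq> {..<length (c @ [1])}" "(\<Sum>k\<leftarrow>r. (c @ [1]) ! k) = n"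
    "\<forall>a\<in>dsum c. \<psi> a = diag_block_mat (map (\<lambda>k. (a @ [0\<^sub>m 1 1]) ! k) r)"
    using carr bd by (rule mat_block_diagonal_blocks)
  define B where "B x = map (\<lambda>k. (dsum_incl c j x @ [0\<^sub>m 1 1]) ! k) r" for x
  have B: "B x = map (\<lambda>k. if k = j then x else 0\<^sub>m ((c @ [1]) ! k) ((c @ [1]) ! k)) r" for x
    unfolding B_def using r(1) by (intro map_cong refl dsum_incl_snoc_nth[OF j]) auto
  have eq: "\<psi> (dsum_incl c j x) = diag_block_mat (B x)" if "x \<in> carrier_mat (c ! j) (c ! j)" for x
    using that r(3) by (simp add: B_def)
  show "lp_bounded p (lp_op_norm p x) (\<psi> (dsum_incl c j x))" if x: "x \<in> carrier_mat (c ! j) (c ! j)"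
    unfolding eq[OF x]
  proof (rule lp_bounded_diag_block_mat[OF p lp_op_norm_nonneg[OF p]], rule)
    fix A assume "A \<in> set (B x)"
    hence "A = x \<or> (\<exists>m. A = 0\<^sub>m m m)" unfolding B by auto
    thus "square_mat A \<and> lp_bounded p (lp_op_norm p x) A"
      using x p by (auto simp: lp_bounded_op_norm lp_bounded_zero lp_op_norm_nonneg)
  qed
  show "lp_hermitian p n (\<psi> (dsum_incl c j (1\<^sub>m (c ! j))))"
    unfolding eq[OF one_carrier_mat]
  proof (rule lp_hermitian_diag_block_mat[OF p])
    show "\<exists>m. A = 1\<^sub>m m \<or> A = 0\<^sub>m m m" if "A \<in> set (B (1\<^sub>m (c ! j)))" for A
      using that unfolding B by auto
    have "map dim_row (B (1\<^sub>m (c ! j))) = map (\<lambda>k. (c @ [1]) ! k) r"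
      unfolding B using j by (auto simp: nth_append)
    thus "sum_list (map dim_row (B (1\<^sub>m (c ! j)))) = n" using r(2) by (simp only:)
  qed
qed

lemma lp_hermitian_conj:
  assumes E: "E \<in> carrier_mat n n" and s: "s \<in> carrier_mat n n" "s' \<in> carrier_mat n n" "s' * s = 1\<^sub>m n"
    and contr: "lp_contraction p s" "lp_contraction p s'" and herm: "lp_hermitian p n E"
  shows "lp_hermitian p n (s' * E * s)"
  unfolding lp_hermitian_def
proof (intro allI impI)
  fix z :: complex assume z: "cmod z = 1"
  define V where "V = 1\<^sub>m n + (z - 1) \<cdot>\<^sub>m E"
  have V: "V \<in> carrier_mat n n" using E by (simp add: V_def)
  have "lp_contraction p V" using herm z by (simp add: lp_hermitian_def V_def)
  hence "lp_contraction p (s' * V * s)"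
    using s V contr by (intro lp_contraction_mult[of _ n n _ n] mult_carrier_mat[of _ n n])
  moreover have "s' * V * s = 1\<^sub>m n + (z - 1) \<cdot>\<^sub>m (s' * E * s)"
  proof -
    have "s' * V * s = (s' + (z - 1) \<cdot>\<^sub>m (s' * E)) * s"
      unfolding V_def using s E
      by (subst mult_add_distrib_mat[of _ n n _ n]) (auto simp: mult_smult_distrib[of _ n n _ n])
    also have "\<dots> = 1\<^sub>m n + (z - 1) \<cdot>\<^sub>m (s' * E * s)"
      using s E by (subst add_mult_distrib_mat[of _ n n _ _ n]) (auto simp: mult_smult_assoc_mat[of _ n n _ n])
    finally show ?thesis .
  qed
  ultimately show "lp_contraction p (1\<^sub>m n + (z - 1) \<cdot>\<^sub>m (s' * E * s))" by simp
qed

section \<open>Assembling the components\<close>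

lemma dsum_norm_le_iff:
  "a \<noteq> [] \<Longrightarrow> dsum_norm p a \<le> K \<longleftrightarrow> (\<forall>k<length a. lp_op_norm p (a ! k) \<le> K)"
  by (simp add: dsum_norm_def all_set_conv_all_nth)

lemma dsum_norm_eq_1:
  assumes "a \<noteq> []" "\<And>k. k < length a \<Longrightarrow> lp_op_norm p (a ! k) = 1"
  shows "dsum_norm p a = 1"
proof -
  have "lp_op_norm p ` set a = {1}"
  proof -
    have "lp_op_norm p ` set a = (\<lambda>_. 1) ` set a"
      using assms(2) by (intro image_cong) (auto simp: in_set_conv_nth)
    thus ?thesis using assms(1) by (simp add: image_constant_conv)
  qed
  thus ?thesis by (simp add: dsum_norm_def)
qed

text \<open>
  The norm of the exponentials is required to be exactly \<open>1\<close>, and as it is a maximum this yields the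
  upper bound \<open>1\<close> in every component. For the converse, in each component the exponentials at \<open>t\<close> and
  \<open>-t\<close> are contractions inverse to each other; as the size is positive, their norm is \<open>1\<close>.
\<close>

lemma hermitian_idempotent_iff:
  assumes p: "0 < p" and d: "d \<noteq> []" "\<forall>n\<in>set d. 0 < n"
    and e: "e \<in> dsum d" "dsum_mult e e = e"
  shows "hermitian_idempotent p d e \<longleftrightarrow> (\<forall>k<length d. lp_hermitian p (d ! k) (e ! k))"
proof -
  define X where "X t = dsum_exp (dsum_smult (\<i> * complex_of_real t) e)" for t
  have len: "length e = length d" using e(1) by (rule dsum_length)
  have ek: "e ! k \<in> carrier_mat (d ! k) (d ! k)" "e ! k * e ! k = e ! k" if "k < length d" for k
  proof -
    show "e ! k \<in> carrier_mat (d ! k) (d ! k)" using e(1) that by (rule dsum_nth)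
    have "e ! k * e ! k = dsum_mult e e ! k" using that len by simp
    thus "e ! k * e ! k = e ! k" by (simp only: e(2))
  qed
  have lenX: "length (X t) = length d" "X t \<noteq> []" for t
    using len d by (auto simp: X_def dsum_exp_def)
  have X: "X t ! k = 1\<^sub>m (d ! k) + (cis t - 1) \<cdot>\<^sub>m e ! k" if "k < length d" for t k
    using that len mat_exp_smult_idempotent[OF ek[OF that]]
    by (simp add: X_def dsum_exp_def cis_conv_exp)
  have "(\<forall>t. dsum_norm p (X t) = 1) \<longleftrightarrow> (\<forall>k<length d. lp_hermitian p (d ! k) (e ! k))"
  proof
    assume norm: "\<forall>t. dsum_norm p (X t) = 1"
    show "\<forall>k<length d. lp_hermitian p (d ! k) (e ! k)"
      unfolding lp_hermitian_def
    proof (intro allI impI)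
      fix k z assume k: "k < length d" and z: "cmod z = 1"
      have "cis (Arg z) = z" using z cis_Arg[of z] by (cases "z = 0") (auto simp: sgn_div_norm)
      moreover have "lp_op_norm p (X (Arg z) ! k) \<le> 1"
        using norm dsum_norm_le_iff[OF lenX(2), of p "Arg z" 1] k lenX(1) by auto
      ultimately show "lp_contraction p (1\<^sub>m (d ! k) + (z - 1) \<cdot>\<^sub>m e ! k)"
        using p k by (simp add: X lp_op_norm_le_iff)
    qed
  next
    assume herm: "\<forall>k<length d. lp_hermitian p (d ! k) (e ! k)"
    show "\<forall>t. dsum_norm p (X t) = 1"
    proof (intro allI dsum_norm_eq_1[OF lenX(2)])
      fix t k assume "k < length (X t)"
      hence k: "k < length d" by (simp add: lenX)
      have inv: "X (- t) ! k * X t ! k = 1\<^sub>m (d ! k)"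
        unfolding X[OF k] one_plus_idempotent_mult[OF ek[OF k]] cis_mult
        using ek[OF k] by (intro eq_matI) auto
      show "lp_op_norm p (X t ! k) = 1"
        using p d k ek[OF k] herm inv
        by (intro lp_op_norm_invertible_contraction[of p "d ! k" _ "X (- t) ! k"])
          (auto simp: X lp_hermitian_def)
    qed
  qed
  thus ?thesis using e unfolding hermitian_idempotent_def X_def by blast
qed

lemma dsum_hom_imp_dsum_mat_hom:
  assumes hom: "dsum_hom c d \<phi>" and c: "\<forall>n\<in>set c. 0 < n" and k: "k < length d"
  shows "dsum_mat_hom c (d ! k) (\<lambda>a. \<phi> a ! k)"
proof
  have len: "length (\<phi> a) = length d" if "a \<in> dsum c" for a
    using hom that by (auto simp: dsum_hom_def dest: dsum_length)
  show "0 < c ! j" if "j < length c" for j using c that by simp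
  show "\<phi> a ! k \<in> carrier_mat (d ! k) (d ! k)" if "a \<in> dsum c" for a
    using hom that k by (intro dsum_nth) (auto simp: dsum_hom_def)
  show "\<phi> (dsum_add a b) ! k = \<phi> a ! k + \<phi> b ! k" if "a \<in> dsum c" "b \<in> dsum c" for a b
    using hom that k len by (simp add: dsum_hom_def)
  show "\<phi> (dsum_mult a b) ! k = \<phi> a ! k * \<phi> b ! k" if "a \<in> dsum c" "b \<in> dsum c" for a b
    using hom that k len by (simp add: dsum_hom_def)
  show "\<phi> (dsum_smult z a) ! k = z \<cdot>\<^sub>m \<phi> a ! k" if "a \<in> dsum c" for a z
    using hom that k len by (simp add: dsum_hom_def)
qed

lemma dsum_mult_nth:
  "a \<in> dsum d \<Longrightarrow> b \<in> dsum d \<Longrightarrow> k < length d \<Longrightarrow> dsum_mult a b ! k = a ! k * b ! k"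
  by (simp add: dsum_length)

lemma dsum_hom_conj:
  assumes hom: "dsum_hom c d \<phi>" and s: "s \<in> dsum d" "s' \<in> dsum d" "dsum_mult s' s = dsum_one d"
  shows "dsum_hom c d (\<lambda>a. dsum_mult (dsum_mult s (\<phi> a)) s')"
proof -
  have \<phi>: "\<phi> a \<in> dsum d" if "a \<in> dsum c" for a using hom that by (simp add: dsum_hom_def)
  have len: "length (\<phi> a) = length d" if "a \<in> dsum c" for a using \<phi>[OF that] by (rule dsum_length)
  note lens = len dsum_length[OF s(1)] dsum_length[OF s(2)]
  have carr: "s ! k \<in> carrier_mat (d ! k) (d ! k)" "s' ! k \<in> carrier_mat (d ! k) (d ! k)"
    "s' ! k * s ! k = 1\<^sub>m (d ! k)" if "k < length d" for k
    using that s dsum_mult_nth[OF s(2,1) that] by (auto simp: dsum_nth dsum_one_def)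
  show ?thesis
    unfolding dsum_hom_def
  proof (intro conjI ballI allI)
    fix a assume "a \<in> dsum c"
    thus "dsum_mult (dsum_mult s (\<phi> a)) s' \<in> dsum d" using s \<phi> by simp
  next
    fix a b assume ab: "a \<in> dsum c" "b \<in> dsum c"
    show "dsum_mult (dsum_mult s (\<phi> (dsum_add a b))) s' =
        dsum_add (dsum_mult (dsum_mult s (\<phi> a)) s') (dsum_mult (dsum_mult s (\<phi> b)) s')"
    proof (rule dsum_eqI[of _ d])
      fix k assume k: "k < length d"
      note A = dsum_nth[OF \<phi>[OF ab(1)] k] and B = dsum_nth[OF \<phi>[OF ab(2)] k]
      have "s ! k * (\<phi> a ! k + \<phi> b ! k) * s' ! k = s ! k * \<phi> a ! k * s' ! k + s ! k * \<phi> b ! k * s' ! k"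
        using carr[OF k] A B
        by (subst mult_add_distrib_mat[OF carr(1)[OF k] A B])
           (intro add_mult_distrib_mat[of _ "d ! k" "d ! k" _ _ "d ! k"] mult_carrier_mat[of _ "d ! k" "d ! k"])
      thus "dsum_mult (dsum_mult s (\<phi> (dsum_add a b))) s' ! k =
        dsum_add (dsum_mult (dsum_mult s (\<phi> a)) s') (dsum_mult (dsum_mult s (\<phi> b)) s') ! k"
        using k hom ab s by (simp add: dsum_hom_def lens)
    qed (use s \<phi> hom ab in \<open>simp_all add: dsum_hom_def\<close>)
    show "dsum_mult (dsum_mult s (\<phi> (dsum_mult a b))) s' =
        dsum_mult (dsum_mult (dsum_mult s (\<phi> a)) s') (dsum_mult (dsum_mult s (\<phi> b)) s')"
    proof (rule dsum_eqI[of _ d])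
      fix k assume k: "k < length d"
      note A = dsum_nth[OF \<phi>[OF ab(1)] k] and B = dsum_nth[OF \<phi>[OF ab(2)] k]
      let ?n = "d ! k"
      have "(s ! k * \<phi> a ! k * s' ! k) * (s ! k * \<phi> b ! k * s' ! k) =
          s ! k * \<phi> a ! k * (s' ! k * s ! k) * \<phi> b ! k * s' ! k"
        using carr(1,2)[OF k] A B
        by (simp add: assoc_mult_mat[of _ ?n ?n _ ?n _ ?n] mult_carrier_mat[of _ ?n ?n])
      also have "\<dots> = s ! k * (\<phi> a ! k * \<phi> b ! k) * s' ! k"
        using carr[OF k] A B by (simp add: assoc_mult_mat[of _ ?n ?n _ ?n _ ?n] mult_carrier_mat[of _ ?n ?n])
      finally show "dsum_mult (dsum_mult s (\<phi> (dsum_mult a b))) s' ! k =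
        dsum_mult (dsum_mult (dsum_mult s (\<phi> a)) s') (dsum_mult (dsum_mult s (\<phi> b)) s') ! k"
        using k hom ab s by (simp add: dsum_hom_def lens)
    qed (use s \<phi> hom ab in \<open>simp_all add: dsum_hom_def\<close>)
  next
    fix a z assume a: "a \<in> dsum c"
    show "dsum_mult (dsum_mult s (\<phi> (dsum_smult z a))) s' = dsum_smult z (dsum_mult (dsum_mult s (\<phi> a)) s')"
    proof (rule dsum_eqI[of _ d])
      fix k assume k: "k < length d"
      note A = dsum_nth[OF \<phi>[OF a] k]
      let ?n = "d ! k"
      have "s ! k * (z \<cdot>\<^sub>m \<phi> a ! k) * s' ! k = z \<cdot>\<^sub>m (s ! k * \<phi> a ! k * s' ! k)"
        using carr(1,2)[OF k] A by (simp add: mult_smult_distrib[of _ ?n ?n _ ?n]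
          mult_smult_assoc_mat[of _ ?n ?n _ ?n] mult_carrier_mat[of _ ?n ?n])
      thus "dsum_mult (dsum_mult s (\<phi> (dsum_smult z a))) s' ! k =
          dsum_smult z (dsum_mult (dsum_mult s (\<phi> a)) s') ! k"
        using k hom a s by (simp add: dsum_hom_def lens)
    next
      show "dsum_smult z (dsum_mult (dsum_mult s (\<phi> a)) s') \<in> dsum d"
        using s \<phi>[OF a] by (intro dsum_smult_carrier dsum_mult_carrier)
    qed (use s \<phi> hom a in \<open>simp_all add: dsum_hom_def\<close>)
  qed
qed

text \<open>
  A map given by choosing a conjugating matrix in each component is controlled only on the direct sum
  itself, and only its values there matter.
\<close>

lemma mat_block_diagonal_cong:
  assumes eq: "\<And>a. a \<in> dsum c \<Longrightarrow> f a = g a" and f: "mat_block_diagonal c n f"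
  shows "mat_block_diagonal c n g"
proof -
  have one: "f (dsum_one c) = g (dsum_one c)" by (simp add: eq)
  have uni: "unitization c n f b = unitization c n g b" if "b \<in> dsum (c @ [1])" for b
    using that by (cases rule: dsum_snoc_cases) (simp add: unitization_def one eq)
  show ?thesis
    using f eq uni unfolding mat_block_diagonal_def unital_block_diagonal_def one
    by (simp split: if_splits)
qed


lemma spatial_imp_similar_block_diagonal:
  assumes p: "0 < p" "p \<noteq> 2" and c: "\<forall>n\<in>set c. 0 < n"
    and d: "d \<noteq> []" "\<forall>n\<in>set d. 0 < n" and hom: "dsum_hom c d \<phi>" and sp: "spatial p c d \<phi>"
  shows "\<exists>\<psi>. dsum_hom c d \<psi> \<and> block_diagonal c d \<psi> \<and> isometrically_similar p c d \<phi> \<psi>"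
proof -
  have \<phi>: "\<phi> a \<in> dsum d" if "a \<in> dsum c" for a using hom that by (simp add: dsum_hom_def)
  have len: "length (\<phi> a) = length d" "\<phi> a \<noteq> []" if "a \<in> dsum c" for a
    using dsum_length[OF \<phi>[OF that]] d by auto
  define P where "P k s s' \<longleftrightarrow>
      s \<in> carrier_mat (d ! k) (d ! k) \<and> s' \<in> carrier_mat (d ! k) (d ! k) \<and>
      s * s' = 1\<^sub>m (d ! k) \<and> s' * s = 1\<^sub>m (d ! k) \<and>
      lp_contraction p s \<and> lp_contraction p s' \<and>
      mat_block_diagonal c (d ! k) (\<lambda>a. s * \<phi> a ! k * s')" for k s s'
  have "\<exists>s s'. P k s s'" if k: "k < length d" for k
    unfolding P_def
  proof (rule mat_hom_block_diagonalization[OF p])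
    show "0 < d ! k" using d k by simp
    show "dsum_mat_hom c (d ! k) (\<lambda>a. \<phi> a ! k)"
      by (rule dsum_hom_imp_dsum_mat_hom[OF hom c k])
  next
    fix j and x :: "complex mat" assume j: "j < length c" and x: "x \<in> carrier_mat (c ! j) (c ! j)"
    hence "dsum_norm p (\<phi> (dsum_incl c j x)) \<le> lp_op_norm p x" using sp by (simp add: spatial_def)
    thus "lp_op_norm p (\<phi> (dsum_incl c j x) ! k) \<le> lp_op_norm p x"
      using dsum_norm_le_iff[OF len(2)[OF dsum_incl_carrier[OF x]]] len(1)[OF dsum_incl_carrier[OF x]] k
      by simp
  next
    fix j assume j: "j < length c"
    let ?e = "\<phi> (dsum_incl c j (1\<^sub>m (c ! j)))"
    have "hermitian_idempotent p d ?e" using sp j by (simp add: spatial_def)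
    moreover from this have "?e \<in> dsum d" "dsum_mult ?e ?e = ?e"
      by (simp_all add: hermitian_idempotent_def)
    ultimately show "lp_hermitian p (d ! k) (?e ! k)"
      using hermitian_idempotent_iff[OF p(1) d] k by blast
  qed
  hence "\<forall>k\<in>{..<length d}. \<exists>w. P k (fst w) (snd w)" by simp
  then obtain w where w: "\<forall>k\<in>{..<length d}. P k (fst (w k)) (snd (w k))"
    by (rule bchoice[THEN exE])
  define s s' where "s k = fst (w k)" and "s' k = snd (w k)" for k
  have s: "s k \<in> carrier_mat (d ! k) (d ! k)" "s' k \<in> carrier_mat (d ! k) (d ! k)"
    "s k * s' k = 1\<^sub>m (d ! k)" "s' k * s k = 1\<^sub>m (d ! k)"
    "lp_contraction p (s k)" "lp_contraction p (s' k)"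
    "mat_block_diagonal c (d ! k) (\<lambda>a. s k * \<phi> a ! k * s' k)" if "k < length d" for k
    using w that by (simp_all add: s_def s'_def P_def)
  define S S' where "S = map s [0..<length d]" and "S' = map s' [0..<length d]"
  have S: "S \<in> dsum d" "S' \<in> dsum d" using s(1,2) by (auto simp: S_def S'_def dsum_def)
  have one: "dsum_mult S S' = dsum_one d" "dsum_mult S' S = dsum_one d"
    using s(3,4) by (auto intro!: nth_equalityI simp: S_def S'_def dsum_one_def)
  have norm: "dsum_norm p S = 1" "dsum_norm p S' = 1"
  proof -
    have "lp_op_norm p (s k) = 1" "lp_op_norm p (s' k) = 1" if "k < length d" for k
      using lp_op_norm_invertible_contraction[OF p(1) _ s(1,2)[OF that] s(4)[OF that] s(5,6)[OF that]]
        lp_op_norm_invertible_contraction[OF p(1) _ s(2,1)[OF that] s(3)[OF that] s(6,5)[OF that]]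
        d that by simp_all
    thus "dsum_norm p S = 1" "dsum_norm p S' = 1"
      using d by (auto intro!: dsum_norm_eq_1 simp: S_def S'_def)
  qed
  define \<psi> where "\<psi> a = dsum_mult (dsum_mult S (\<phi> a)) S'" for a
  have "dsum_hom c d \<psi>"
    unfolding \<psi>_def by (rule dsum_hom_conj[OF hom S one(2)])
  moreover have "block_diagonal c d \<psi>"
    unfolding block_diagonal_def
  proof (intro allI impI)
    fix k assume k: "k < length d"
    show "mat_block_diagonal c (d ! k) (\<lambda>a. \<psi> a ! k)"
    proof (rule mat_block_diagonal_cong)
      show "mat_block_diagonal c (d ! k) (\<lambda>a. s k * \<phi> a ! k * s' k)"
        by (rule s(7)[OF k])
    next
      fix a assume "a \<in> dsum c"
      thus "s k * \<phi> a ! k * s' k = \<psi> a ! k"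
        using k len by (simp add: \<psi>_def S_def S'_def)
    qed
  qed
  moreover have "isometrically_similar p c d \<phi> \<psi>"
    unfolding isometrically_similar_def using S one norm \<psi>_def by blast
  ultimately show ?thesis by blast
qed

text \<open>
  Conjugating back writes \<open>\<phi>(a)\<close> as \<open>s' \<psi>(a) s\<close> with contractions \<open>s\<close> and \<open>s'\<close>, so both conditions are
  inherited from \<open>\<psi>\<close>.
\<close>

lemma similar_block_diagonal_imp_spatial:
  assumes p: "0 < p" and c: "\<forall>n\<in>set c. 0 < n"
    and d: "d \<noteq> []" "\<forall>n\<in>set d. 0 < n" and hom: "dsum_hom c d \<phi>"
    and \<psi>: "dsum_hom c d \<psi>" "block_diagonal c d \<psi>" "isometrically_similar p c d \<phi> \<psi>"
  shows "spatial p c d \<phi>"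
proof -
  obtain s s' where s: "s \<in> dsum d" "s' \<in> dsum d"
    "dsum_mult s s' = dsum_one d" "dsum_mult s' s = dsum_one d"
    "dsum_norm p s = 1" "dsum_norm p s' = 1"
    and eq: "\<forall>a\<in>dsum c. \<psi> a = dsum_mult (dsum_mult s (\<phi> a)) s'"
    using \<psi>(3) unfolding isometrically_similar_def by metis
  have \<phi>: "\<phi> a \<in> dsum d" if "a \<in> dsum c" for a using hom that by (simp add: dsum_hom_def)
  have carr: "s ! k \<in> carrier_mat (d ! k) (d ! k)" "s' ! k \<in> carrier_mat (d ! k) (d ! k)"
    if "k < length d" for k using that s by (simp_all add: dsum_nth)
  have inv: "s' ! k * s ! k = 1\<^sub>m (d ! k)" if "k < length d" for k
    using dsum_mult_nth[OF s(2,1) that] that by (simp add: s(4) dsum_one_def)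
  have contr: "lp_contraction p (s ! k)" "lp_contraction p (s' ! k)" if "k < length d" for k
  proof -
    have "s \<noteq> []" "s' \<noteq> []" using d dsum_length[OF s(1)] dsum_length[OF s(2)] by auto
    hence "lp_op_norm p (s ! k) \<le> 1" "lp_op_norm p (s' ! k) \<le> 1"
      using s(5,6) that dsum_norm_le_iff[of s p 1] dsum_norm_le_iff[of s' p 1]
        dsum_length[OF s(1)] dsum_length[OF s(2)] by auto
    thus "lp_contraction p (s ! k)" "lp_contraction p (s' ! k)" using p by (simp_all add: lp_op_norm_le_iff)
  qed
  have \<phi>_eq: "\<phi> a ! k = s' ! k * \<psi> a ! k * s ! k" if a: "a \<in> dsum c" and k: "k < length d" for a k
  proof -
    let ?n = "d ! k" and ?A = "\<phi> a ! k"
    have A: "?A \<in> carrier_mat ?n ?n" using \<phi>[OF a] k by (rule dsum_nth)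
    have "\<psi> a ! k = s ! k * ?A * s' ! k"
      using eq a k dsum_length[OF s(1)] dsum_length[OF s(2)] dsum_length[OF \<phi>[OF a]] by simp
    hence "s' ! k * \<psi> a ! k * s ! k = (s' ! k * s ! k) * ?A * (s' ! k * s ! k)"
      using carr[OF k] A
      by (simp add: assoc_mult_mat[of _ ?n ?n _ ?n _ ?n] mult_carrier_mat[of _ ?n ?n])
    also have "\<dots> = ?A" using A carrier_matD[OF A] by (simp add: inv[OF k])
    finally show ?thesis by simp
  qed
  have \<psi>_carr: "\<psi> a ! k \<in> carrier_mat (d ! k) (d ! k)" if "a \<in> dsum c" "k < length d" for a k
    using \<psi>(1) that by (auto simp: dsum_hom_def intro: dsum_nth)
  have bd: "mat_block_diagonal c (d ! k) (\<lambda>a. \<psi> a ! k)" if "k < length d" for k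
    using \<psi>(2) that by (simp add: block_diagonal_def)
  show ?thesis
    unfolding spatial_def
  proof (intro allI impI conjI ballI)
    fix j and x :: "complex mat" assume j: "j < length c" and x: "x \<in> carrier_mat (c ! j) (c ! j)"
    let ?a = "dsum_incl c j x"
    have a: "?a \<in> dsum c" using x by simp
    have len: "length (\<phi> ?a) = length d" using \<phi>[OF a] by (rule dsum_length)
    hence ne: "\<phi> ?a \<noteq> []" using d by auto
    show "dsum_norm p (\<phi> ?a) \<le> lp_op_norm p x"
      unfolding dsum_norm_le_iff[OF ne] len
    proof (intro allI impI)
      fix k assume k: "k < length d"
      let ?n = "d ! k"
      have "lp_bounded p (lp_op_norm p x) (\<psi> ?a ! k)"
        by (rule block_diagonal_incl_bound(1)[OF p \<psi>_carr[OF _ k] bd[OF k] j x])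
      hence "lp_bounded p (1 * lp_op_norm p x * 1) (s' ! k * \<psi> ?a ! k * s ! k)"
        using carr[OF k] contr[OF k] \<psi>_carr[OF a k] lp_op_norm_nonneg[OF p, of x]
        by (intro lp_bounded_mult[of _ ?n ?n _ ?n] mult_carrier_mat[of _ ?n ?n]) auto
      thus "lp_op_norm p (\<phi> ?a ! k) \<le> lp_op_norm p x"
        by (simp add: \<phi>_eq[OF a k] lp_op_norm_le_iff[OF p lp_op_norm_nonneg[OF p]])
    qed
  next
    fix j assume j: "j < length c"
    let ?a = "dsum_incl c j (1\<^sub>m (c ! j))"
    have a: "?a \<in> dsum c" by simp
    have "dsum_mult ?a ?a = ?a"
      using j by (intro nth_equalityI) (auto simp: dsum_incl_def nth_list_update)
    hence idem: "dsum_mult (\<phi> ?a) (\<phi> ?a) = \<phi> ?a" using hom a unfolding dsum_hom_def by metis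
    show "hermitian_idempotent p d (\<phi> ?a)"
      unfolding hermitian_idempotent_iff[OF p d \<phi>[OF a] idem]
    proof (intro allI impI)
      fix k assume k: "k < length d"
      have "lp_hermitian p (d ! k) (\<psi> ?a ! k)"
        by (rule block_diagonal_incl_bound(2)[OF p \<psi>_carr[OF _ k] bd[OF k] j])
      thus "lp_hermitian p (d ! k) (\<phi> ?a ! k)"
        unfolding \<phi>_eq[OF a k]
        by (intro lp_hermitian_conj[OF \<psi>_carr[OF a k] carr[OF k] inv[OF k] contr[OF k]])
    qed
  qed
qed

theorem lemma8p20:
  fixes p :: real and c d :: "nat list"
    and \<phi> :: "complex mat list \<Rightarrow> complex mat list"
  assumes "1 \<le> p" and "p \<noteq> 2"
    and "c \<noteq> []" and "\<forall>n\<in>set c. 0 < n"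
    and "d \<noteq> []" and "\<forall>n\<in>set d. 0 < n"
    and "dsum_hom c d \<phi>"
  shows "spatial p c d \<phi> \<longleftrightarrow>
    (\<exists>\<psi>. dsum_hom c d \<psi> \<and> block_diagonal c d \<psi> \<and> isometrically_similar p c d \<phi> \<psi>)"
proof
  have p: "0 < p" using assms(1) by simp
  {
    assume "spatial p c d \<phi>"
    thus "\<exists>\<psi>. dsum_hom c d \<psi> \<and> block_diagonal c d \<psi> \<and> isometrically_similar p c d \<phi> \<psi>"
      by (rule spatial_imp_similar_block_diagonal[OF p assms(2,4,5,6,7)])
  next
    assume "\<exists>\<psi>. dsum_hom c d \<psi> \<and> block_diagonal c d \<psi> \<and> isometrically_similar p c d \<phi> \<psi>"
    thus "spatial p c d \<phi>"
      using similar_block_diagonal_imp_spatial[OF p assms(4-7)] by blast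
  }
qed

end
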